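(* Let $n\ge 1$ and let $z_1,\dots,z_n\in\mathbb{C}$. In the algebra $\mathbb{D}[\mathfrak{S}_n]$ of $\mathbb{C}[\mathfrak{S}_n]$-valued linear differential operators with rational function coefficients, the operators $$\mathcal{D}^+_n=\Big(\sum_{k,l\ge 0,\ k+l\le n}\partial_u^{\,n-k}\,u^{n-k-l}\,\beta^+_{k,l}\Big)\frac{1}{w(u)},\qquad \mathcal{D}^-_n=\frac{1}{w(u)}\Big(\sum_{k,l\ge 0,\ k+l\le n}(-1)^k\beta^-_{k,l}\,u^{n-k-l}\,\partial_u^{\,n-k}\Big)$$ satisfy $$\mathcal{D}^+_n\,\mathcal{D}^-_n=\partial_u^{2n}.$$
   Context: $\mathbb{D}=\mathbb{C}(u)[\partial_u]$ is the (noncommutative) algebra of linear differential operators in $u$ with rational function coefficients; it contains $\mathbb{C}(u)$ as a commutative subalgebra and satisfies $\partial_u g-g\partial_u=g'$ for $g\in\mathbb{C}(u)$. $\mathfrak{S}_n$ is the symmetric group on $[n]=\{1,\dots,n\}$, and $\mathbb{D}[\mathfrak{S}_n]=\mathbb{D}\otimes_{\mathbb{C}}\mathbb{C}[\mathfrak{S}_n]$, with $\Psi\in\mathbb{D}$ identified with $\Psi\otimes 1_{\mathfrak{S}_n}$ and $\gamma\in\mathbb{C}[\mathfrak{S}_n]$ with $1\otimes\gamma$ (so elements of $\mathbb{D}$ commute with elements of $\mathbb{C}[\mathfrak{S}_n]$). $w(u)=(u+z_1)\cdots(u+z_n)$. For $X\subseteq[n]$: $z_X=\prod_{i\in X}z_i$;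 $\mathfrak{S}_X=\{\sigma\in\mathfrak{S}_n\mid\sigma(i)=i\text{ for }i\notin X\}$; $\alpha^+_X=\sum_{\sigma\in\mathfrak{S}_X}\sigma$ and $\alpha^-_X=\sum_{\sigma\in\mathfrak{S}_X}\mathrm{sgn}(\sigma)\,\sigma$ in $\mathbb{C}[\mathfrak{S}_n]$. For $0\le k,l\le n$, $\beta^\pm_{k,l}=\sum_{|X|=k,\ |Y|=l,\ X\cap Y=\emptyset}\alpha^\pm_X\,z_Y$, the sum being over pairs of disjoint subsets $X,Y\subseteq[n]$ (so $\beta^\pm_{k,l}=0$ if $k+l>n$). *)

theory Defs
  imports
    Complex_Main
    "HOL-Library.Poly_Mapping"
    "HOL-Combinatorics.Perm"
    "HOL-Combinatorics.Permutations"
    "HOL-Computational_Algebra.Polynomial_Factorial"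
begin

section \<open>The field \<open>\<complex>(u)\<close> and its derivation\<close>

type_synonym ratfun = "complex poly fract"

definition rf_deriv :: "ratfun \<Rightarrow> ratfun" where
  "rf_deriv f = (THE g. \<exists>p q. q \<noteq> 0 \<and> f = Fract p q \<and>
     g = Fract (pderiv p * q - p * pderiv q) (q * q))"

lemma Fract_pderiv_cong:
  fixes p q r s :: "complex poly"
  assumes "q \<noteq> 0" "s \<noteq> 0" "Fract p q = Fract r s"
  shows "Fract (pderiv p * q - p * pderiv q) (q * q) = Fract (pderiv r * s - r * pderiv s) (s * s)"
proof -
  have eq: "p * s = r * q" using assms by (simp add: eq_fract)
  have "pderiv (p * s) = pderiv (r * q)" using eq by simp
  then have d: "pderiv p * s + p * pderiv s = pderiv r * q + r * pderiv q"
    by (simp add: pderiv_mult algebra_simps)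
  have "(pderiv p * q - p * pderiv q) * (s * s) - (pderiv r * s - r * pderiv s) * (q * q)
      = q * s * ((pderiv p * s + p * pderiv s) - (pderiv r * q + r * pderiv q))
        - (p * s - r * q) * (q * pderiv s + s * pderiv q)"
    by (simp add: algebra_simps)
  then have "(pderiv p * q - p * pderiv q) * (s * s) = (pderiv r * s - r * pderiv s) * (q * q)"
    using d eq by simp
  then show ?thesis using assms by (simp add: eq_fract)
qed

lemma rf_deriv_Fract:
  assumes "q \<noteq> 0"
  shows "rf_deriv (Fract p q) = Fract (pderiv p * q - p * pderiv q) (q * q)"
  unfolding rf_deriv_def
proof (rule the_equality)
  show "\<exists>p' q'. q' \<noteq> 0 \<and> Fract p q = Fract p' q' \<and>
      Fract (pderiv p * q - p * pderiv q) (q * q) = Fract (pderiv p' * q' - p' * pderiv q') (q' * q')"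
    using assms by blast
qed (use Fract_pderiv_cong assms in metis)

lemma rf_deriv_add: "rf_deriv (f + g) = rf_deriv f + rf_deriv g"
  by (cases f; cases g)
     (simp add: rf_deriv_Fract eq_fract pderiv_add pderiv_mult algebra_simps)

lemma rf_deriv_mult: "rf_deriv (f * g) = rf_deriv f * g + f * rf_deriv g"
  by (cases f; cases g)
     (simp add: rf_deriv_Fract eq_fract pderiv_mult algebra_simps)

lemma rf_deriv_to_fract: "rf_deriv (to_fract p) = to_fract (pderiv p)"
  by (simp add: to_fract_def rf_deriv_Fract)

lemma rf_deriv_0 [simp]: "rf_deriv 0 = 0"
  using rf_deriv_to_fract[of 0] by simp

lemma rf_deriv_sum: "rf_deriv (sum f A) = (\<Sum>x\<in>A. rf_deriv (f x))"
  by (induction A rule: infinite_finite_induct) (simp_all add: rf_deriv_add)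

lemma rf_deriv_pow_to_fract: "(rf_deriv ^^ i) (to_fract p) = to_fract ((pderiv ^^ i) p)"
  by (induction i) (simp_all add: rf_deriv_to_fract)


section \<open>The algebra \<open>\<complex>(u)[\<partial>\<^sub>u]\<close>\<close>

text \<open>
  Differential operators are represented by their action on \<open>\<complex>(u)\<close>, so that the product is
  composition. The action is faithful: lemma \<open>is_diffop_coeffs_unique\<close> below shows
  that the powers of \<open>\<partial>\<^sub>u\<close> are linearly independent over \<open>\<complex>(u)\<close>.
\<close>

definition is_diffop :: "(ratfun \<Rightarrow> ratfun) \<Rightarrow> bool" where
  "is_diffop L \<longleftrightarrow> (\<exists>N a. \<forall>f. L f = (\<Sum>i\<le>N. a i * (rf_deriv ^^ i) f))"

lemma is_diffop_coeffs_unique: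
  assumes "\<And>f. (\<Sum>i\<le>N. a i * (rf_deriv ^^ i) f) = (\<Sum>i\<le>N. b i * (rf_deriv ^^ i) f)"
    and "i \<le> N"
  shows "a i = b i"
  using assms(2)
proof (induction i rule: less_induct)
  case (less i)
  let ?f = "to_fract (monom (1 :: complex) i)"
  have high: "(rf_deriv ^^ j) ?f = 0" if "i < j" for j
    using that
    by (intro trans[OF rf_deriv_pow_to_fract])
       (simp add: poly_eq_iff coeff_higher_pderiv)
  have "coeff ((pderiv ^^ i) (monom (1 :: complex) i)) 0 \<noteq> 0"
    by (simp add: coeff_higher_pderiv pochhammer_fact[symmetric])
  then have top: "(rf_deriv ^^ i) ?f \<noteq> 0"
    by (auto simp: rf_deriv_pow_to_fract)
  have "(\<Sum>j\<le>N. c j * (rf_deriv ^^ j) ?f)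
      = (\<Sum>j<i. c j * (rf_deriv ^^ j) ?f) + c i * (rf_deriv ^^ i) ?f" for c
  proof -
    have "(\<Sum>j\<le>N. c j * (rf_deriv ^^ j) ?f) = (\<Sum>j\<le>i. c j * (rf_deriv ^^ j) ?f)"
      using less.prems high by (intro sum.mono_neutral_right) auto
    then show ?thesis by (simp add: lessThan_Suc_atMost[symmetric])
  qed
  moreover have "(\<Sum>j<i. a j * (rf_deriv ^^ j) ?f) = (\<Sum>j<i. b j * (rf_deriv ^^ j) ?f)"
    using less by (intro sum.cong) auto
  ultimately have "a i * (rf_deriv ^^ i) ?f = b i * (rf_deriv ^^ i) ?f"
    using assms(1)[of ?f] by simp
  with top show ?case by simp
qed

lemma is_diffopI: "(\<And>f. L f = (\<Sum>i\<le>N. a i * (rf_deriv ^^ i) f)) \<Longrightarrow> is_diffop L"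
  unfolding is_diffop_def by blast

lemma is_diffop_mult: "is_diffop (\<lambda>f. g * f)"
  by (rule is_diffopI[where N = 0 and a = "\<lambda>_. g"]) simp

lemma is_diffop_zero: "is_diffop (\<lambda>_. 0)"
  using is_diffop_mult[of 0] by simp

lemma is_diffop_id: "is_diffop (\<lambda>f. f)"
  using is_diffop_mult[of 1] by simp

lemma is_diffop_deriv: "is_diffop rf_deriv"
  by (rule is_diffopI[where N = 1 and a = "\<lambda>i. if i = 1 then 1 else 0"]) simp

lemma is_diffop_add:
  assumes "is_diffop L" "is_diffop M"
  shows "is_diffop (\<lambda>f. L f + M f)"
proof -
  obtain N a where L: "\<And>f. L f = (\<Sum>i\<le>N. a i * (rf_deriv ^^ i) f)"
    using assms(1) unfolding is_diffop_def by blast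
  obtain K b where M: "\<And>f. M f = (\<Sum>i\<le>K. b i * (rf_deriv ^^ i) f)"
    using assms(2) unfolding is_diffop_def by blast
  have pad: "(\<Sum>i\<le>m. c i * (rf_deriv ^^ i) f)
      = (\<Sum>i\<le>max N K. (if i \<le> m then c i else 0) * (rf_deriv ^^ i) f)"
    if "m \<le> max N K" for m c f
    using that by (intro sum.mono_neutral_cong_left) auto
  show ?thesis
    by (rule is_diffopI[where N = "max N K" and
          a = "\<lambda>i. (if i \<le> N then a i else 0) + (if i \<le> K then b i else 0)"])
       (simp only: L M pad[OF max.cobounded1] pad[OF max.cobounded2] distrib_right sum.distrib)
qed

lemma is_diffop_scale:
  assumes "is_diffop L"
  shows "is_diffop (\<lambda>f. g * L f)"
proof -
  obtain N a where L: "\<And>f. L f = (\<Sum>i\<le>N. a i * (rf_deriv ^^ i) f)"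
    using assms unfolding is_diffop_def by blast
  show ?thesis
    by (rule is_diffopI[where N = N and a = "\<lambda>i. g * a i"])
       (simp add: L sum_distrib_left mult.assoc)
qed

lemma is_diffop_sum:
  assumes "\<And>i. i \<in> A \<Longrightarrow> is_diffop (L i)"
  shows "is_diffop (\<lambda>f. \<Sum>i\<in>A. L i f)"
  using assms
  by (induction A rule: infinite_finite_induct) (auto intro: is_diffop_add is_diffop_zero)

lemma is_diffop_deriv_comp:
  assumes "is_diffop L"
  shows "is_diffop (\<lambda>f. rf_deriv (L f))"
proof -
  obtain N a where L: "\<And>f. L f = (\<Sum>i\<le>N. a i * (rf_deriv ^^ i) f)"
    using assms unfolding is_diffop_def by blast
  have pow: "is_diffop (\<lambda>f. (rf_deriv ^^ i) f)" for i
    by (rule is_diffopI[where N = i and a = "\<lambda>j. if j = i then 1 else 0"])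
       (simp add: if_distrib[of "\<lambda>x. x * _"] sum.delta cong: if_cong)
  have "is_diffop (\<lambda>f. \<Sum>i\<le>N. rf_deriv (a i) * (rf_deriv ^^ i) f + a i * (rf_deriv ^^ Suc i) f)"
    by (intro is_diffop_sum is_diffop_add is_diffop_scale pow)
  then show ?thesis
    by (simp add: L rf_deriv_sum rf_deriv_mult)
qed

lemma is_diffop_comp:
  assumes "is_diffop L" "is_diffop M"
  shows "is_diffop (\<lambda>f. L (M f))"
proof -
  obtain N a where L: "\<And>f. L f = (\<Sum>i\<le>N. a i * (rf_deriv ^^ i) f)"
    using assms(1) unfolding is_diffop_def by blast
  have "is_diffop (\<lambda>f. (rf_deriv ^^ i) (M f))" for i
    by (induction i) (simp_all add: assms(2) is_diffop_deriv_comp)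
  then show ?thesis
    unfolding L by (intro is_diffop_sum is_diffop_scale)
qed

lemma is_diffop_additive:
  assumes "is_diffop L"
  shows "L (f + g) = L f + L g"
proof -
  have "(rf_deriv ^^ i) (f + g) = (rf_deriv ^^ i) f + (rf_deriv ^^ i) g" for i
    by (induction i) (simp_all add: rf_deriv_add)
  with assms show ?thesis
    by (auto simp: is_diffop_def sum.distrib distrib_left)
qed

typedef diffop = "{L. is_diffop L}"
  morphisms diffop_apply Diffop
  using is_diffop_zero by blast

setup_lifting type_definition_diffop

lemma diffop_eqI: "(\<And>f. diffop_apply L f = diffop_apply M f) \<Longrightarrow> L = M"
  by (simp add: diffop_apply_inject[symmetric] fun_eq_iff)

instantiation diffop :: ring_1
begin

lift_definition zero_diffop :: diffop is "\<lambda>_. 0" by (rule is_diffop_zero)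
lift_definition one_diffop :: diffop is "\<lambda>f. f" by (rule is_diffop_id)
lift_definition plus_diffop :: "diffop \<Rightarrow> diffop \<Rightarrow> diffop" is "\<lambda>L M f. L f + M f"
  by (rule is_diffop_add)
lift_definition uminus_diffop :: "diffop \<Rightarrow> diffop" is "\<lambda>L f. - L f"
  using is_diffop_scale[of _ "- 1"] by simp
lift_definition minus_diffop :: "diffop \<Rightarrow> diffop \<Rightarrow> diffop" is "\<lambda>L M f. L f - M f"
  using is_diffop_add[OF _ is_diffop_scale[of _ "- 1"]] by simp
lift_definition times_diffop :: "diffop \<Rightarrow> diffop \<Rightarrow> diffop" is "\<lambda>L M f. L (M f)"
  by (rule is_diffop_comp)

instance
proof
  fix a b c :: diffop
  show "a * (b + c) = a * b + a * c"
    by transfer (auto simp: is_diffop_additive)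
  show "(0 :: diffop) \<noteq> 1"
    by transfer (metis zero_neq_one)
qed (transfer; simp add: algebra_simps)+

end

lemmas diffop_apply_simps =
  zero_diffop.rep_eq one_diffop.rep_eq plus_diffop.rep_eq uminus_diffop.rep_eq
  minus_diffop.rep_eq times_diffop.rep_eq

definition mult_op :: "ratfun \<Rightarrow> diffop" where
  "mult_op g = Diffop (\<lambda>f. g * f)"

definition d_u :: diffop where
  "d_u = Diffop rf_deriv"

lemma apply_mult_op [simp]: "diffop_apply (mult_op g) f = g * f"
  by (simp add: mult_op_def Diffop_inverse is_diffop_mult)

lemma apply_d_u [simp]: "diffop_apply d_u f = rf_deriv f"
  by (simp add: d_u_def Diffop_inverse is_diffop_deriv)

lemma d_u_commutator: "d_u * mult_op g - mult_op g * d_u = mult_op (rf_deriv g)"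
  by (rule diffop_eqI) (simp add: diffop_apply_simps rf_deriv_mult)

lemma mult_op_hom:
  "mult_op (f + g) = mult_op f + mult_op g"
  "mult_op (f * g) = mult_op f * mult_op g"
  "mult_op 0 = 0"
  "mult_op 1 = 1"
  by (rule diffop_eqI; simp add: diffop_apply_simps algebra_simps)+

definition const_op :: "complex \<Rightarrow> diffop" where
  "const_op c = mult_op (to_fract [:c:])"

lemma const_op_central: "const_op c * L = L * const_op c"
proof -
  have pow: "(rf_deriv ^^ i) (to_fract [:c:] * f) = to_fract [:c:] * (rf_deriv ^^ i) f" for i f
    by (induction i) (simp_all add: rf_deriv_mult rf_deriv_to_fract)
  obtain N a where L: "\<And>f. diffop_apply L f = (\<Sum>i\<le>N. a i * (rf_deriv ^^ i) f)"
    using diffop_apply[of L] by (auto simp: is_diffop_def)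
  show ?thesis
    by (rule diffop_eqI)
       (simp add: const_op_def diffop_apply_simps L pow sum_distrib_left mult.left_commute)
qed


section \<open>The algebra \<open>\<complex>(u)[\<partial>\<^sub>u] \<otimes> \<complex>[S\<^sub>n]\<close>\<close>

text \<open>
  The convolution product of type \<open>poly_mapping\<close> is indexed by an additively written monoid.
  Permutations are therefore given an additive structure whose sum is the composition product.
\<close>

instantiation Perm.perm :: (type) monoid_add
begin

definition zero_perm :: "'a perm" where "zero_perm = 1"
definition plus_perm :: "'a perm \<Rightarrow> 'a perm \<Rightarrow> 'a perm" where "plus_perm \<sigma> \<tau> = \<sigma> * \<tau>"

instance by standard (simp_all add: zero_perm_def plus_perm_def mult.assoc)

end

text \<open>
  \<open>S\<^sub>n\<close> is realised inside the finitary permutations of the natural numbers, so the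
  algebras \<open>\<complex>[S\<^sub>n]\<close> and \<open>\<complex>(u)[\<partial>\<^sub>u] \<otimes> \<complex>[S\<^sub>n]\<close> become the subalgebras of
  elements supported on \<open>sym_grp n\<close> in the following two types.
\<close>

type_synonym csym = "nat perm \<Rightarrow>\<^sub>0 complex"
type_synonym dsym = "nat perm \<Rightarrow>\<^sub>0 diffop"

definition sym_grp :: "nat \<Rightarrow> nat perm set" where
  "sym_grp n = {\<sigma>. \<forall>i. i \<notin> {1..n} \<longrightarrow> Perm.apply \<sigma> i = i}"

definition sym_grp_on :: "nat \<Rightarrow> nat set \<Rightarrow> nat perm set" where
  "sym_grp_on n X = {\<sigma> \<in> sym_grp n. \<forall>i\<in>{1..n}. i \<notin> X \<longrightarrow> Perm.apply \<sigma> i = i}"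

lemma sym_grp_eq_permutes: "Perm.apply ` sym_grp n = {p. p permutes {1..n}}"
proof (intro set_eqI iffI)
  fix p assume "p \<in> {p. p permutes {1..n}}"
  then have p: "p permutes {1..n}" by simp
  moreover have "finite {a. p a \<noteq> a}"
    using p by (intro finite_subset[OF _ finite_atLeastAtMost[of 1 n]])
      (auto simp del: atLeastAtMost_iff dest: permutes_not_in)
  ultimately have "Perm.apply (Perm p) = p"
    by (simp add: Perm_inverse permutes_bij)
  moreover from this p have "Perm p \<in> sym_grp n"
    by (simp add: sym_grp_def permutes_not_in)
  ultimately show "p \<in> Perm.apply ` sym_grp n" by force
next
  fix p assume "p \<in> Perm.apply ` sym_grp n"
  then obtain \<sigma> where "p = Perm.apply \<sigma>" "\<forall>i. i \<notin> {1..n} \<longrightarrow> p i = i"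
    by (auto simp: sym_grp_def)
  moreover from this have "bij p" by simp
  ultimately show "p \<in> {p. p permutes {1..n}}"
    unfolding permutes_def bij_iff by blast
qed

lemma finite_sym_grp: "finite (sym_grp n)"
  by (rule finite_imageD[where f = "Perm.apply"])
     (simp_all add: sym_grp_eq_permutes finite_permutations inj_on_def apply_inject)

lemma finite_sym_grp_on: "finite (sym_grp_on n X)"
  by (rule finite_subset[OF _ finite_sym_grp[of n]]) (auto simp: sym_grp_on_def)

definition of_op :: "diffop \<Rightarrow> dsym" where
  "of_op \<Psi> = Poly_Mapping.single 0 \<Psi>"

definition of_csym :: "csym \<Rightarrow> dsym" where
  "of_csym \<gamma> = Poly_Mapping.map const_op \<gamma>"

definition alpha_plus :: "nat \<Rightarrow> nat set \<Rightarrow> csym" where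
  "alpha_plus n X = (\<Sum>\<sigma>\<in>sym_grp_on n X. Poly_Mapping.single \<sigma> 1)"

definition alpha_minus :: "nat \<Rightarrow> nat set \<Rightarrow> csym" where
  "alpha_minus n X = (\<Sum>\<sigma>\<in>sym_grp_on n X. Poly_Mapping.single \<sigma> (of_int (sign (Perm.apply \<sigma>))))"

definition disjoint_pairs :: "nat \<Rightarrow> nat \<Rightarrow> nat \<Rightarrow> (nat set \<times> nat set) set" where
  "disjoint_pairs n k l =
     {(X, Y). X \<subseteq> {1..n} \<and> Y \<subseteq> {1..n} \<and> card X = k \<and> card Y = l \<and> X \<inter> Y = {}}"

lemma finite_disjoint_pairs: "finite (disjoint_pairs n k l)"
  by (rule finite_subset[of _ "Pow {1..n} \<times> Pow {1..n}"]) (auto simp: disjoint_pairs_def)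

definition beta_plus :: "nat \<Rightarrow> (nat \<Rightarrow> complex) \<Rightarrow> nat \<Rightarrow> nat \<Rightarrow> csym" where
  "beta_plus n z k l =
     (\<Sum>(X, Y)\<in>disjoint_pairs n k l. alpha_plus n X * Poly_Mapping.single 0 (\<Prod>i\<in>Y. z i))"

definition beta_minus :: "nat \<Rightarrow> (nat \<Rightarrow> complex) \<Rightarrow> nat \<Rightarrow> nat \<Rightarrow> csym" where
  "beta_minus n z k l =
     (\<Sum>(X, Y)\<in>disjoint_pairs n k l. alpha_minus n X * Poly_Mapping.single 0 (\<Prod>i\<in>Y. z i))"

definition u_var :: ratfun where
  "u_var = to_fract [:0, 1:]"

definition w_poly :: "nat \<Rightarrow> (nat \<Rightarrow> complex) \<Rightarrow> ratfun" where
  "w_poly n z = (\<Prod>i\<in>{1..n}. u_var + to_fract [:z i:])"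

lemma finite_degree_pairs: "finite {(k, l). k + l \<le> (n :: nat)}"
  by (rule finite_subset[of _ "{..n} \<times> {..n}"]) auto

definition D_plus :: "nat \<Rightarrow> (nat \<Rightarrow> complex) \<Rightarrow> dsym" where
  "D_plus n z =
     (\<Sum>(k, l)\<in>{(k, l). k + l \<le> n}.
        of_op (d_u ^ (n - k) * mult_op (u_var ^ (n - k - l))) * of_csym (beta_plus n z k l))
     * of_op (mult_op (1 / w_poly n z))"

definition D_minus :: "nat \<Rightarrow> (nat \<Rightarrow> complex) \<Rightarrow> dsym" where
  "D_minus n z =
     of_op (mult_op (1 / w_poly n z))
     * (\<Sum>(k, l)\<in>{(k, l). k + l \<le> n}.
          (- 1) ^ k * of_csym (beta_minus n z k l)
          * of_op (mult_op (u_var ^ (n - k - l)) * d_u ^ (n - k)))"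


subsection \<open>The operators lie in the algebra for \<open>S\<^sub>n\<close>\<close>

definition dsym_n :: "nat \<Rightarrow> dsym set" where
  "dsym_n n = {x. Poly_Mapping.keys x \<subseteq> sym_grp n}"

lemma w_poly_nonzero: "w_poly n z \<noteq> 0"
proof -
  have "u_var + to_fract [:c:] = to_fract [:c, 1:]" for c
    by (simp add: u_var_def flip: to_fract_add)
  then show ?thesis by (simp add: w_poly_def)
qed

lemma keys_single_0_sym_grp: "Poly_Mapping.keys (Poly_Mapping.single 0 c) \<subseteq> sym_grp n"
  by (simp add: sym_grp_def zero_perm_def)

lemma keys_mult_sym_grp:
  assumes "Poly_Mapping.keys x \<subseteq> sym_grp n" "Poly_Mapping.keys y \<subseteq> sym_grp n"
  shows "Poly_Mapping.keys (x * y) \<subseteq> sym_grp n"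
proof -
  have "\<sigma> + \<tau> \<in> sym_grp n" if "\<sigma> \<in> sym_grp n" "\<tau> \<in> sym_grp n" for \<sigma> \<tau>
    using that by (simp add: sym_grp_def plus_perm_def times_perm.rep_eq)
  with assms show ?thesis
    using keys_mult[of x y] by blast
qed

lemma keys_sum_sym_grp:
  assumes "\<And>i. i \<in> A \<Longrightarrow> Poly_Mapping.keys (f i) \<subseteq> sym_grp n"
  shows "Poly_Mapping.keys (sum f A) \<subseteq> sym_grp n"
  using assms
proof (induction A rule: infinite_finite_induct)
  case (insert x F)
  then show ?case
    using Poly_Mapping.keys_add[of "f x" "sum f F"] by (simp, blast)
qed simp_all

lemma lookup_of_csym:
  "Poly_Mapping.lookup (of_csym \<gamma>) \<sigma> = const_op (Poly_Mapping.lookup \<gamma> \<sigma>)"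
proof -
  have "const_op 0 = 0" by (simp add: const_op_def mult_op_hom)
  then show ?thesis unfolding of_csym_def by (simp add: map.rep_eq when_def)
qed

lemma keys_of_csym:
  assumes "Poly_Mapping.keys \<gamma> \<subseteq> sym_grp n"
  shows "Poly_Mapping.keys (of_csym \<gamma>) \<subseteq> sym_grp n"
proof
  fix \<sigma> assume "\<sigma> \<in> Poly_Mapping.keys (of_csym \<gamma>)"
  then have "Poly_Mapping.lookup \<gamma> \<sigma> \<noteq> 0"
    by (auto simp: in_keys_iff lookup_of_csym const_op_def mult_op_hom)
  with assms show "\<sigma> \<in> sym_grp n" by (auto simp: in_keys_iff)
qed

lemma keys_alpha_sym_grp:
  "Poly_Mapping.keys (alpha_plus n X) \<subseteq> sym_grp n"
  "Poly_Mapping.keys (alpha_minus n X) \<subseteq> sym_grp n"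
  unfolding alpha_plus_def alpha_minus_def
  by (rule keys_sum_sym_grp; simp add: sym_grp_on_def)+

lemma keys_beta_sym_grp:
  "Poly_Mapping.keys (beta_plus n z k l) \<subseteq> sym_grp n"
  "Poly_Mapping.keys (beta_minus n z k l) \<subseteq> sym_grp n"
  unfolding beta_plus_def beta_minus_def case_prod_unfold
  by (rule keys_sum_sym_grp keys_mult_sym_grp keys_alpha_sym_grp keys_single_0_sym_grp)+

lemma D_plus_in_dsym_n: "D_plus n z \<in> dsym_n n"
proof -
  have "Poly_Mapping.keys (D_plus n z) \<subseteq> sym_grp n"
    unfolding D_plus_def of_op_def case_prod_unfold
    by (rule keys_sum_sym_grp keys_mult_sym_grp keys_single_0_sym_grp keys_of_csym keys_beta_sym_grp)+
  then show ?thesis by (simp add: dsym_n_def)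
qed

lemma D_minus_in_dsym_n: "D_minus n z \<in> dsym_n n"
proof -
  have sign: "Poly_Mapping.keys ((- 1) ^ k :: dsym) \<subseteq> sym_grp n" for k
  proof (induction k)
    case (Suc k)
    have "(- 1 :: dsym) = Poly_Mapping.single 0 (- 1)"
      by (simp add: single_uminus)
    with Suc show ?case
      by (simp only: power_Suc keys_mult_sym_grp keys_single_0_sym_grp)
  qed (simp add: sym_grp_def zero_perm_def)
  have "Poly_Mapping.keys (D_minus n z) \<subseteq> sym_grp n"
    unfolding D_minus_def of_op_def case_prod_unfold
    by (rule keys_sum_sym_grp keys_mult_sym_grp sign keys_single_0_sym_grp keys_of_csym
        keys_beta_sym_grp)+
  then show ?thesis by (simp add: dsym_n_def)
qed

end

theory Submission
  imports Defs
begin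

text \<open>
  Write \<open>x\<^sub>X = \<Prod>\<^bsub>i\<in>X\<^esub> 1/(u + z\<^sub>i)\<close>. Summing over \<open>Y\<close> first turns the operators into
  \<open>\<Sum>\<^sub>X \<partial>\<^bsup>n-|X|\<^esup> x\<^sub>X \<alpha>\<^sup>+\<^sub>X\<close> and \<open>\<Sum>\<^sub>X (-1)\<^bsup>|X|\<^esup> \<alpha>\<^sup>-\<^sub>X x\<^sub>X \<partial>\<^bsup>n-|X|\<^esup>\<close>. In the product, a pair \<open>(X, Y)\<close> with
  \<open>|X \<inter> Y| \<ge> 2\<close> contributes \<open>\<alpha>\<^sup>+\<^sub>X \<alpha>\<^sup>-\<^sub>Y = 0\<close>. The remaining pairs are grouped by \<open>U = X \<union> Y\<close>: the empty
  \<open>U\<close> gives \<open>\<partial>\<^bsup>2n\<^esup>\<close>, and every nonempty \<open>U\<close>, of size \<open>m\<close> say, gives zero, as follows.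

  Let \<open>C\<^sub>q\<close> be the sum of \<open>\<alpha>\<^sup>+\<^sub>X \<alpha>\<^sup>-\<^sub>Y\<close> over the pairs with \<open>X \<inter> Y = {}\<close> and \<open>|Y| = q\<close>, and \<open>T\<^sub>q\<close> the sum over
  those with \<open>X \<inter> Y = {i}\<close> and \<open>|Y| = q + 1\<close>. Then \<open>C\<^sub>q = T\<^sub>q + T\<^bsub>q-1\<^esub>\<close>, so \<open>T\<^sub>q\<close> does not depend on
  \<open>i \<in> U\<close>. Hence the pairs meeting in one point only involve \<open>\<Sum>\<^bsub>i\<in>U\<^esub> x\<^sub>U x\<^sub>i = - [\<partial>, x\<^sub>U]\<close>, and with
  \<open>E\<^sub>b = \<partial>\<^bsup>n-m+b\<^esup> x\<^sub>U \<partial>\<^bsup>n-b\<^esup>\<close> their total \<open>\<Sum>\<^sub>q (-1)\<^sup>q (E\<^bsub>q+1\<^esub> - E\<^sub>q) T\<^sub>q\<close> cancels the total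
  \<open>\<Sum>\<^sub>b (-1)\<^sup>b E\<^sub>b C\<^sub>b\<close> of the disjoint pairs by summation by parts.
\<close>

section \<open>Character sums over symmetric groups\<close>

text \<open>The symmetric group of \<open>X\<close> over any type, free of the ambient
  \<open>n\<close>; for \<open>X\<close> inside \<open>{1..n}\<close> it agrees with
  \<open>sym_grp_on n X\<close>.\<close>

definition perms_on :: "'a set \<Rightarrow> 'a perm set" where
  "perms_on X = {\<sigma>. \<forall>i. i \<notin> X \<longrightarrow> Perm.apply \<sigma> i = i}"

text \<open>Carrying the character as a parameter treats \<open>alpha^+\<close> (trivial character)
  and \<open>alpha^-\<close> (sign) at once; the lemmas below use mostly that \<open>\<chi>\<close>
  is multiplicative.\<close>

definition sym_sum :: "('a perm \<Rightarrow> complex) \<Rightarrow> 'a set \<Rightarrow> 'a perm \<Rightarrow>\<^sub>0 complex" where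
  "sym_sum \<chi> X = (\<Sum>\<sigma>\<in>perms_on X. Poly_Mapping.single \<sigma> (\<chi> \<sigma>))"

definition sgn_perm :: "'a perm \<Rightarrow> complex" where
  "sgn_perm \<sigma> = of_int (sign (Perm.apply \<sigma>))"

lemma permutation_apply: "permutation (Perm.apply \<sigma>)"
  using finite_affected[of \<sigma>] by (simp add: permutation affected.rep_eq)

lemma sgn_perm_mult: "sgn_perm (\<sigma> * \<tau>) = sgn_perm \<sigma> * sgn_perm \<tau>"
  by (simp add: sgn_perm_def times_perm.rep_eq sign_compose permutation_apply)

lemma sgn_perm_one [simp]: "sgn_perm 1 = 1"
  by (simp add: sgn_perm_def one_perm.rep_eq)

lemma sgn_perm_swap: "p \<noteq> q \<Longrightarrow> sgn_perm (Perm.swap p q) = -1"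
  by (simp add: sgn_perm_def swap.rep_eq sign_swap_id)

lemma perms_on_mult: "\<sigma> \<in> perms_on X \<Longrightarrow> \<tau> \<in> perms_on X \<Longrightarrow> \<sigma> * \<tau> \<in> perms_on X"
  by (simp add: perms_on_def apply_times)

lemma apply_inverse_cancel [simp]:
  "Perm.apply \<sigma> (Perm.apply (inverse \<sigma>) i) = i"
  "Perm.apply (inverse \<sigma>) (Perm.apply \<sigma> i) = i"
  by (simp_all add: apply_sequence)

lemma perms_on_inverse: "\<sigma> \<in> perms_on X \<Longrightarrow> inverse \<sigma> \<in> perms_on X"
  unfolding perms_on_def mem_Collect_eq by (metis apply_inverse_cancel(2))

lemma swap_in_perms_on: "p \<in> X \<Longrightarrow> q \<in> X \<Longrightarrow> Perm.swap p q \<in> perms_on X"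
  by (auto simp: perms_on_def swap.rep_eq transpose_def)

lemma perms_on_maps_into: "\<sigma> \<in> perms_on X \<Longrightarrow> i \<in> X \<Longrightarrow> Perm.apply \<sigma> i \<in> X"
  unfolding perms_on_def using apply_inj by (metis (mono_tags, lifting) mem_Collect_eq)

lemma perms_on_singleton: "perms_on {i} = {1}"
proof -
  have "\<sigma> = 1" if "\<sigma> \<in> perms_on {i}" for \<sigma>
    using that perms_on_maps_into[OF that, of i]
    by (intro perm_eqI) (auto simp: perms_on_def)
  then show ?thesis by (auto simp: perms_on_def)
qed

lemma perms_on_empty: "perms_on {} = {1}"
  by (auto simp: perms_on_def intro: perm_eqI)

lemma single_one_perm: "Poly_Mapping.single (1 :: 'a perm) (1 :: complex) = 1"
  by (simp flip: zero_perm_def)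

lemma sym_sum_trivial:
  assumes "\<chi> 1 = 1"
  shows "sym_sum \<chi> {} = 1" "sym_sum \<chi> {i} = 1"
  using assms by (simp_all add: sym_sum_def perms_on_empty perms_on_singleton single_one_perm)

lemma character_inverse:
  fixes \<chi> :: "'a perm \<Rightarrow> complex"
  assumes "\<And>\<sigma> \<tau>. \<chi> (\<sigma> * \<tau>) = \<chi> \<sigma> * \<chi> \<tau>" "\<chi> 1 = 1"
  shows "\<chi> \<sigma> * \<chi> (inverse \<sigma>) = 1"
  by (metis assms perm.right_inverse)

lemma perm_mult_inverse_cancel:
  "inverse t * (t * \<sigma>) = (\<sigma> :: 'a perm)" "t * (inverse t * \<sigma>) = \<sigma>"
  by (simp_all flip: mult.assoc)

text \<open>Conjugation by \<open>t\<close> maps the symmetric group of \<open>X\<close> onto that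
  of \<open>t(X)\<close>, and a character with values in a commutative field is constant on
  conjugacy classes.\<close>

lemma sym_sum_conj:
  assumes hom: "\<And>\<sigma> \<tau>. \<chi> (\<sigma> * \<tau>) = \<chi> \<sigma> * \<chi> \<tau>" "\<chi> 1 = 1"
  shows "Poly_Mapping.single t c * sym_sum \<chi> X = sym_sum \<chi> (Perm.apply t ` X) * Poly_Mapping.single t c"
proof -
  have conj: "t * \<sigma> * inverse t \<in> perms_on (Perm.apply t ` X)" if "\<sigma> \<in> perms_on X" for \<sigma>
  proof -
    have "Perm.apply (t * \<sigma> * inverse t) i = i" if "i \<notin> Perm.apply t ` X" for i
    proof -
      have "Perm.apply t (Perm.apply (inverse t) i) = i"
        by simp
      moreover from this that have "Perm.apply (inverse t) i \<notin> X" by force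
      ultimately show ?thesis using \<open>\<sigma> \<in> perms_on X\<close> by (simp add: perms_on_def apply_times)
    qed
    then show ?thesis by (simp add: perms_on_def)
  qed
  have conj': "inverse t * \<sigma> * t \<in> perms_on X" if "\<sigma> \<in> perms_on (Perm.apply t ` X)" for \<sigma>
  proof -
    have "Perm.apply (inverse t * \<sigma> * t) i = i" if "i \<notin> X" for i
    proof -
      have "Perm.apply t i \<notin> Perm.apply t ` X" using that by (simp add: image_iff apply_inj)
      then have "Perm.apply \<sigma> (Perm.apply t i) = Perm.apply t i"
        using \<open>\<sigma> \<in> perms_on (Perm.apply t ` X)\<close> unfolding perms_on_def by blast
      then show ?thesis
        by (simp add: apply_times)
    qed
    then show ?thesis by (simp add: perms_on_def)
  qed
  have "\<chi> (t * \<sigma> * inverse t) = \<chi> \<sigma>" for \<sigma>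
    using character_inverse[of \<chi> t] hom by (simp add: mult.commute mult.left_commute)
  then show ?thesis
    unfolding sym_sum_def sum_distrib_left sum_distrib_right mult_single plus_perm_def
    by (intro sum.reindex_bij_witness[of _ "\<lambda>\<sigma>. inverse t * \<sigma> * t" "\<lambda>\<sigma>. t * \<sigma> * inverse t"])
       (use conj conj' in \<open>simp_all add: mult.assoc mult.commute[of c] perm_mult_inverse_cancel\<close>)
qed

text \<open>Translation by \<open>\<tau>\<close> permutes the group \<open>perms_on X\<close>, and
  multiplicativity of \<open>\<chi>\<close> matches the coefficients.\<close>

lemma sym_sum_absorb:
  assumes hom: "\<And>\<sigma> \<tau>. \<chi> (\<sigma> * \<tau>) = \<chi> \<sigma> * \<chi> \<tau>"
    and \<tau>: "\<tau> \<in> perms_on X"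
  shows "Poly_Mapping.single \<tau> (\<chi> \<tau>) * sym_sum \<chi> X = sym_sum \<chi> X"
    and "sym_sum \<chi> X * Poly_Mapping.single \<tau> (\<chi> \<tau>) = sym_sum \<chi> X"
proof -
  show "Poly_Mapping.single \<tau> (\<chi> \<tau>) * sym_sum \<chi> X = sym_sum \<chi> X"
    unfolding sym_sum_def sum_distrib_left mult_single plus_perm_def
    by (rule sum.reindex_bij_witness[of _ "\<lambda>\<sigma>. inverse \<tau> * \<sigma>" "\<lambda>\<sigma>. \<tau> * \<sigma>"])
       (simp_all add: \<tau> perms_on_mult perms_on_inverse hom flip: mult.assoc)
  show "sym_sum \<chi> X * Poly_Mapping.single \<tau> (\<chi> \<tau>) = sym_sum \<chi> X"
    unfolding sym_sum_def sum_distrib_right mult_single plus_perm_def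
    by (rule sum.reindex_bij_witness[of _ "\<lambda>\<sigma>. \<sigma> * inverse \<tau>" "\<lambda>\<sigma>. \<sigma> * \<tau>"])
       (simp_all add: \<tau> perms_on_mult perms_on_inverse hom mult.assoc)
qed

section \<open>Coset decompositions with respect to the stabilizer of a point\<close>

lemma perms_on_fixing: "\<sigma> \<in> perms_on (insert i P) \<Longrightarrow> Perm.apply \<sigma> i = i \<Longrightarrow> \<sigma> \<in> perms_on P"
  by (auto simp: perms_on_def)

lemma perms_on_mono: "X \<subseteq> Y \<Longrightarrow> perms_on X \<subseteq> perms_on Y"
  by (auto simp: perms_on_def)

lemma swap_swap_cancel: "Perm.swap p i * (Perm.swap p i * \<sigma>) = (\<sigma> :: 'a perm)"
  by (metis inverse_swap mult.assoc mult_1 perm.left_inverse)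

lemma swap_swap_cancel': "\<sigma> * Perm.swap p i * Perm.swap p i = (\<sigma> :: 'a perm)"
  by (metis inverse_swap mult.assoc mult_1_right perm.left_inverse)

text \<open>Left cosets of the stabilizer of \<open>i\<close> are indexed by
  \<open>p = \<sigma>(i)\<close>, with representative the transposition \<open>(p i)\<close>; the
  summand \<open>p = i\<close> is the trivial coset.\<close>

lemma sym_sum_insert_left:
  assumes hom: "\<And>\<sigma> \<tau>. \<chi> (\<sigma> * \<tau>) = \<chi> \<sigma> * \<chi> \<tau>"
    and P: "finite P" "i \<notin> P"
  shows "sym_sum \<chi> (insert i P) =
    (\<Sum>p\<in>insert i P. Poly_Mapping.single (Perm.swap p i) (\<chi> (Perm.swap p i))) * sym_sum \<chi> P"
proof -
  have "(\<Sum>p\<in>insert i P. Poly_Mapping.single (Perm.swap p i) (\<chi> (Perm.swap p i))) * sym_sum \<chi> P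
     = (\<Sum>(p, \<rho>)\<in>insert i P \<times> perms_on P.
          Poly_Mapping.single (Perm.swap p i * \<rho>) (\<chi> (Perm.swap p i * \<rho>)))"
    using P by (simp only: sym_sum_def sum_product mult_single plus_perm_def hom sum.cartesian_product)
  also have "\<dots> = sym_sum \<chi> (insert i P)"
    unfolding sym_sum_def
  proof (rule sum.reindex_bij_witness[of _
      "\<lambda>\<sigma>. (Perm.apply \<sigma> i, Perm.swap (Perm.apply \<sigma> i) i * \<sigma>)" "\<lambda>(p, \<rho>). Perm.swap p i * \<rho>"])
    fix x assume x: "x \<in> insert i P \<times> perms_on P"
    then obtain p \<rho> where [simp]: "x = (p, \<rho>)" and p: "p \<in> insert i P" and r: "\<rho> \<in> perms_on P"
      by auto
    have "Perm.apply \<rho> i = i" using r P by (simp add: perms_on_def)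
    then have "Perm.apply (Perm.swap p i * \<rho>) i = p" by (simp add: apply_times)
    then show "(Perm.apply (case x of (p, \<rho>) \<Rightarrow> Perm.swap p i * \<rho>) i,
        Perm.swap (Perm.apply (case x of (p, \<rho>) \<Rightarrow> Perm.swap p i * \<rho>) i) i *
          (case x of (p, \<rho>) \<Rightarrow> Perm.swap p i * \<rho>)) = x"
      by (simp only: \<open>x = _\<close> prod.case swap_swap_cancel)
    show "(case x of (p, \<rho>) \<Rightarrow> Perm.swap p i * \<rho>) \<in> perms_on (insert i P)"
      using p r perms_on_mono[of P "insert i P"] by (auto intro!: perms_on_mult swap_in_perms_on)
  next
    fix \<sigma> assume s: "\<sigma> \<in> perms_on (insert i P)"
    define j where "j = Perm.apply \<sigma> i"
    have j: "j \<in> insert i P"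
      unfolding j_def using s by (rule perms_on_maps_into) simp
    have "Perm.apply (Perm.swap j i * \<sigma>) i = i" by (simp add: apply_times flip: j_def)
    with perms_on_mult[OF swap_in_perms_on[OF j insertI1] s]
    have "Perm.swap j i * \<sigma> \<in> perms_on P" by (rule perms_on_fixing)
    with j show "(Perm.apply \<sigma> i, Perm.swap (Perm.apply \<sigma> i) i * \<sigma>) \<in> insert i P \<times> perms_on P"
      unfolding j_def[symmetric] by blast
  qed (auto simp: swap_swap_cancel)
  finally show ?thesis ..
qed

text \<open>The mirror image with right cosets, now indexed by the preimage \<open>p\<close> of
  \<open>i\<close> under \<open>\<sigma>\<close>.\<close>

lemma sym_sum_insert_right:
  assumes hom: "\<And>\<sigma> \<tau>. \<chi> (\<sigma> * \<tau>) = \<chi> \<sigma> * \<chi> \<tau>"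
    and P: "finite P" "i \<notin> P"
  shows "sym_sum \<chi> (insert i P) =
    sym_sum \<chi> P * (\<Sum>p\<in>insert i P. Poly_Mapping.single (Perm.swap p i) (\<chi> (Perm.swap p i)))"
proof -
  have "sym_sum \<chi> P * (\<Sum>p\<in>insert i P. Poly_Mapping.single (Perm.swap p i) (\<chi> (Perm.swap p i)))
     = (\<Sum>(\<rho>, p)\<in>perms_on P \<times> insert i P.
          Poly_Mapping.single (\<rho> * Perm.swap p i) (\<chi> (\<rho> * Perm.swap p i)))"
    using P by (simp only: sym_sum_def sum_product mult_single plus_perm_def hom sum.cartesian_product)
  also have "\<dots> = sym_sum \<chi> (insert i P)"
    unfolding sym_sum_def
  proof (rule sum.reindex_bij_witness[of _
      "\<lambda>\<sigma>. (\<sigma> * Perm.swap (Perm.apply (inverse \<sigma>) i) i, Perm.apply (inverse \<sigma>) i)"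
      "\<lambda>(\<rho>, p). \<rho> * Perm.swap p i"])
    fix x assume x: "x \<in> perms_on P \<times> insert i P"
    then obtain p \<rho> where [simp]: "x = (\<rho>, p)" and p: "p \<in> insert i P" and r: "\<rho> \<in> perms_on P"
      by auto
    have "Perm.apply (inverse \<rho>) i = i" using perms_on_inverse[OF r] P by (simp add: perms_on_def)
    then have "Perm.apply (inverse (\<rho> * Perm.swap p i)) i = p" by (simp add: apply_times)
    then show "((case x of (\<rho>, p) \<Rightarrow> \<rho> * Perm.swap p i) *
         Perm.swap (Perm.apply (inverse (case x of (\<rho>, p) \<Rightarrow> \<rho> * Perm.swap p i)) i) i,
         Perm.apply (inverse (case x of (\<rho>, p) \<Rightarrow> \<rho> * Perm.swap p i)) i) = x"
      by (simp only: \<open>x = _\<close> prod.case swap_swap_cancel')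
    show "(case x of (\<rho>, p) \<Rightarrow> \<rho> * Perm.swap p i) \<in> perms_on (insert i P)"
      using p r perms_on_mono[of P "insert i P"] by (auto intro!: perms_on_mult swap_in_perms_on)
  next
    fix \<sigma> assume s: "\<sigma> \<in> perms_on (insert i P)"
    define j where "j = Perm.apply (inverse \<sigma>) i"
    have j: "j \<in> insert i P"
      unfolding j_def using s by (intro perms_on_maps_into perms_on_inverse insertI1)
    have "Perm.apply \<sigma> j = i" by (simp add: j_def)
    then have "Perm.apply (\<sigma> * Perm.swap j i) i = i" by (simp add: apply_times)
    with perms_on_mult[OF s swap_in_perms_on[OF j insertI1]]
    have "\<sigma> * Perm.swap j i \<in> perms_on P" by (rule perms_on_fixing)
    with j show "(\<sigma> * Perm.swap (Perm.apply (inverse \<sigma>) i) i, Perm.apply (inverse \<sigma>) i)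
        \<in> perms_on P \<times> insert i P"
      unfolding j_def[symmetric] by blast
  qed (auto simp: swap_swap_cancel')
  finally show ?thesis ..
qed

section \<open>Products of symmetrizers and antisymmetrizers\<close>

text \<open>With two common points, the transposition \<open>t = (p q)\<close> can be inserted
  between the factors: the symmetrizer absorbs it, while the antisymmetrizer turns it into a
  sign.\<close>

lemma sym_sum_annihilate:
  assumes "p \<in> X \<inter> Y" "q \<in> X \<inter> Y" "p \<noteq> q"
  shows "sym_sum (\<lambda>_. 1) X * sym_sum sgn_perm Y = 0"
proof -
  let ?t = "Poly_Mapping.single (Perm.swap p q) (1 :: complex)"
  have 1: "sym_sum (\<lambda>_. 1) X * ?t = sym_sum (\<lambda>_. 1) X"
    using assms by (intro sym_sum_absorb swap_in_perms_on) auto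
  have "Poly_Mapping.single (Perm.swap p q) (sgn_perm (Perm.swap p q)) * sym_sum sgn_perm Y
      = sym_sum sgn_perm Y"
    using assms by (intro sym_sum_absorb swap_in_perms_on sgn_perm_mult) auto
  then have 2: "?t * sym_sum sgn_perm Y = - sym_sum sgn_perm Y"
    using assms by (simp add: sgn_perm_swap single_uminus minus_equation_iff[of "_ * _"])
  have "sym_sum (\<lambda>_. 1) X * sym_sum sgn_perm Y = sym_sum (\<lambda>_. 1) X * (?t * sym_sum sgn_perm Y)"
    using 1 by (simp flip: mult.assoc)
  also have "\<dots> = - (sym_sum (\<lambda>_. 1) X * sym_sum sgn_perm Y)"
    by (simp add: 2)
  \<comment> \<open>The product equals its own negative; vanishing is read off from the complex
    coefficients.\<close>
  finally have "Poly_Mapping.lookup (sym_sum (\<lambda>_. 1) X * sym_sum sgn_perm Y) \<sigma>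
      = - Poly_Mapping.lookup (sym_sum (\<lambda>_. 1) X * sym_sum sgn_perm Y) \<sigma>" for \<sigma>
    by (metis (no_types) lookup_uminus)
  then show ?thesis by (intro poly_mapping_eqI) simp
qed

text \<open>The \<open>C_q\<close> of the overview, with \<open>Y = Q\<close> and
  \<open>X = U - Q\<close>.\<close>

definition disj_sum :: "'a set \<Rightarrow> nat \<Rightarrow> 'a perm \<Rightarrow>\<^sub>0 complex" where
  "disj_sum U q = (\<Sum>Q | Q \<subseteq> U \<and> card Q = q. sym_sum (\<lambda>_. 1) (U - Q) * sym_sum sgn_perm Q)"

text \<open>The \<open>T_q\<close> of the overview, with \<open>V = U - {i}\<close>. Here
  \<open>Q\<close> is \<open>Y\<close> without the common point \<open>i\<close>, so
  \<open>q = |Y| - 1\<close>.\<close>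

definition meet_sum :: "'a set \<Rightarrow> 'a \<Rightarrow> nat \<Rightarrow> 'a perm \<Rightarrow>\<^sub>0 complex" where
  "meet_sum V i q = (\<Sum>Q | Q \<subseteq> V \<and> card Q = q.
     sym_sum (\<lambda>_. 1) (insert i (V - Q)) * sym_sum sgn_perm (insert i Q))"

text \<open>The pairs are split by whether \<open>i\<close> lies in the symmetrized or in the
  antisymmetrized block.\<close>

lemma disj_sum_insert:
  assumes V: "finite V" "i \<notin> V"
  shows "disj_sum (insert i V) (Suc q) =
    (\<Sum>Q | Q \<subseteq> V \<and> card Q = Suc q. sym_sum (\<lambda>_. 1) (insert i (V - Q)) * sym_sum sgn_perm Q)
  + (\<Sum>Q | Q \<subseteq> V \<and> card Q = q. sym_sum (\<lambda>_. 1) (V - Q) * sym_sum sgn_perm (insert i Q))"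
proof -
  have fin: "finite Q" if "Q \<subseteq> V" for Q using that V finite_subset by blast
  have "{Q. Q \<subseteq> insert i V \<and> card Q = Suc q}
      = {Q. Q \<subseteq> V \<and> card Q = Suc q} \<union> insert i ` {Q. Q \<subseteq> V \<and> card Q = q}" (is "?A = ?B \<union> insert i ` ?C")
  proof (intro set_eqI iffI)
    fix Q assume Q: "Q \<in> ?A"
    show "Q \<in> ?B \<union> insert i ` ?C"
    proof (cases "i \<in> Q")
      case True
      then have "Q = insert i (Q - {i})" by auto
      moreover have "Q - {i} \<in> ?C" using True Q by auto
      ultimately show ?thesis by blast
    qed (use Q in auto)
  next
    fix Q assume Q: "Q \<in> ?B \<union> insert i ` ?C"
    have "card (insert i R) = Suc (card R)" if "R \<subseteq> V" for R
      using that V fin by (intro card_insert_disjoint) auto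
    then show "Q \<in> ?A" using Q by auto
  qed
  moreover have "?B \<inter> insert i ` ?C = {}" using V by auto
  moreover have "inj_on (insert i) ?C" using V
    by (intro inj_onI) (metis (mono_tags, lifting) Diff_insert_absorb mem_Collect_eq subsetD)
  moreover have "finite ?B" "finite ?C" using V by (auto intro: finite_subset[of _ "Pow V"])
  moreover have "insert i V - Q = insert i (V - Q)" if "Q \<subseteq> V" for Q using that V by auto
  moreover have "insert i V - insert i Q = V - Q" if "Q \<subseteq> V" for Q using that V by auto
  ultimately show ?thesis
    unfolding disj_sum_def by (simp add: sum.union_disjoint sum.reindex)
qed

text \<open>
  In \<open>\<alpha>\<^sup>+\<^bsub>P+i\<^esub> \<alpha>\<^sup>-\<^bsub>Q+i\<^esub>\<close> expand the right factor over the cosets \<open>\<sigma>(x i)\<close> for \<open>|Q| = q + 1\<close>, and the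
  left factor over the cosets \<open>(x i)\<sigma>\<close> for \<open>|Q| = q\<close>. Conjugation by \<open>(x i)\<close> matches the
  nontrivial cosets under \<open>(P, Q) \<mapsto> (P - x, Q + x)\<close>, where they have opposite signs.
\<close>

lemma meet_sum_rec:
  assumes V: "finite V" "i \<notin> V"
  shows "meet_sum V i (Suc q) + meet_sum V i q = disj_sum (insert i V) (Suc q)"
proof -
  let ?a = "sym_sum (\<lambda>_. 1) :: 'a set \<Rightarrow> 'a perm \<Rightarrow>\<^sub>0 complex" and ?b = "sym_sum sgn_perm"
  let ?s = "\<lambda>p. Poly_Mapping.single (Perm.swap p i) (1 :: complex)"
  let ?K = "\<lambda>q. {Q. Q \<subseteq> V \<and> card Q = q}"
  have fin: "finite Q" if "Q \<subseteq> V" for Q using that V finite_subset by blast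
  have finK: "finite (?K q)" for q using V by (auto intro: finite_subset[of _ "Pow V"])
  \<comment> \<open>The trivial coset gives \<open>?b Q\<close>; every other representative is a
    genuine transposition, whence the minus sign.\<close>
  have b: "?b (insert i Q) = ?b Q - ?b Q * (\<Sum>x\<in>Q. ?s x)" if "Q \<subseteq> V" for Q
  proof -
    have "(\<Sum>x\<in>Q. Poly_Mapping.single (Perm.swap x i) (sgn_perm (Perm.swap x i))) = - (\<Sum>x\<in>Q. ?s x)"
      unfolding sum_negf[symmetric]
      using that V by (intro sum.cong refl) (subst sgn_perm_swap, auto simp: single_uminus)
    moreover have "i \<notin> Q" using that V by auto
    ultimately show ?thesis
      using fin[OF that]
      by (simp add: sym_sum_insert_right sgn_perm_mult single_one_perm right_diff_distrib)
  qed
  have a: "?a (insert i P) = ?a P + (\<Sum>x\<in>P. ?s x) * ?a P" if "P \<subseteq> V" for P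
  proof -
    have "i \<notin> P" using that V by auto
    then show ?thesis
      using fin[OF that] by (simp add: sym_sum_insert_left distrib_right single_one_perm)
  qed
  have 1: "meet_sum V i (Suc q) = (\<Sum>Q\<in>?K (Suc q). ?a (insert i (V - Q)) * ?b Q)
     - (\<Sum>Q\<in>?K (Suc q). \<Sum>x\<in>Q. ?a (insert i (V - Q)) * ?b Q * ?s x)"
    unfolding meet_sum_def sum_subtractf[symmetric]
    by (intro sum.cong refl) (simp add: b right_diff_distrib sum_distrib_left mult.assoc)
  have 2: "meet_sum V i q = (\<Sum>Q\<in>?K q. ?a (V - Q) * ?b (insert i Q))
     + (\<Sum>Q\<in>?K q. \<Sum>x\<in>V - Q. ?s x * ?a (V - Q) * ?b (insert i Q))"
    unfolding meet_sum_def sum.distrib[symmetric]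
    by (intro sum.cong refl) (simp add: a distrib_right sum_distrib_right mult.assoc)
  have img: "Perm.apply (Perm.swap x i) ` S = S" if "x \<notin> S" "i \<notin> S" for x S
    using that by (auto simp: swap.rep_eq image_iff transpose_def)
  have swap: "?s x * ?a (V - Q) * ?b (insert i Q) = ?a (insert i (V - insert x Q)) * ?b (insert x Q) * ?s x"
    if "Q \<subseteq> V" "x \<in> V - Q" for Q x
  proof -
    \<comment> \<open>With \<open>x\<close> split off, the image under \<open>(x i)\<close> is
      visible: \<open>x\<close> goes to \<open>i\<close>, and the remaining set contains neither
      point and stays fixed.\<close>
    have "V - Q = insert x (V - insert x Q)" using that by auto
    then have "?s x * ?a (V - Q) = ?a (insert i (V - insert x Q)) * ?s x"
      using that V by (simp add: sym_sum_conj img)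
    moreover have "i \<notin> Q" "x \<notin> Q" using that V by auto
    then have "?s x * ?b (insert i Q) = ?b (insert x Q) * ?s x"
      by (simp add: sym_sum_conj img sgn_perm_mult)
    ultimately show ?thesis by (simp add: mult.assoc)
  qed
  have "(\<Sum>Q\<in>?K q. \<Sum>x\<in>V - Q. ?s x * ?a (V - Q) * ?b (insert i Q))
      = (\<Sum>(Q, x)\<in>Sigma (?K q) (\<lambda>Q. V - Q). ?a (insert i (V - insert x Q)) * ?b (insert x Q) * ?s x)"
    using V finK by (subst sum.Sigma) (auto intro!: sum.cong swap)
  also have "\<dots> = (\<Sum>(Q, x)\<in>Sigma (?K (Suc q)) (\<lambda>Q. Q). ?a (insert i (V - Q)) * ?b Q * ?s x)"
    by (rule sum.reindex_bij_witness[of _ "\<lambda>(Q, x). (Q - {x}, x)" "\<lambda>(Q, x). (insert x Q, x)"])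
       (use fin in \<open>auto simp: insert_absorb\<close>)
  also have "\<dots> = (\<Sum>Q\<in>?K (Suc q). \<Sum>x\<in>Q. ?a (insert i (V - Q)) * ?b Q * ?s x)"
    using V finK fin by (subst sum.Sigma) auto
  finally show ?thesis
    unfolding 1 2 using disj_sum_insert[OF V] by simp
qed

text \<open>Only \<open>Q = {}\<close> occurs, and the antisymmetrizers of \<open>{}\<close> and
  \<open>{i}\<close> are both 1. This starts the recursion as if \<open>T_q\<close> were 0 at
  \<open>q = -1\<close>.\<close>

lemma meet_sum_0:
  assumes "finite V"
  shows "meet_sum V i 0 = disj_sum (insert i V) 0"
proof -
  have "{Q. Q \<subseteq> W \<and> card Q = 0} = {{}}" if "finite W" for W :: "'a set"
    using finite_subset[OF _ that] by auto
  then show ?thesis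
    using assms by (simp add: meet_sum_def disj_sum_def sym_sum_trivial del: card_eq_0_iff)
qed

lemma meet_sum_card_lt:
  assumes "finite V" "card V < q"
  shows "meet_sum V i q = 0"
proof -
  have "{Q. Q \<subseteq> V \<and> card Q = q} = {}"
    using assms(2) by (auto dest: card_mono[OF assms(1)])
  then show ?thesis unfolding meet_sum_def by (simp only: sum.empty)
qed

text \<open>The recursion and its initial value involve \<open>i\<close> only through
  \<open>insert i V = U\<close>, so they determine the same sequence for every point of
  \<open>U\<close>.\<close>

lemma meet_sum_indep:
  assumes "finite U" "i \<in> U" "j \<in> U"
  shows "meet_sum (U - {i}) i q = meet_sum (U - {j}) j q"
proof (induction q)
  case 0
  then show ?case using assms by (simp add: meet_sum_0 insert_absorb)
next
  case (Suc q)
  have "meet_sum (U - {i}) i (Suc q) + meet_sum (U - {i}) i q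
      = meet_sum (U - {j}) j (Suc q) + meet_sum (U - {j}) j q"
    using assms by (simp add: meet_sum_rec insert_absorb)
  then show ?case using Suc by simp
qed

section \<open>Expansion of the operators\<close>

lemma of_op_hom:
  "of_op (a + b) = of_op a + of_op b"
  "of_op (a - b) = of_op a - of_op b"
  "of_op (- a) = - of_op a"
  "of_op (a * b) = of_op a * of_op b"
  "of_op 0 = 0"
  "of_op 1 = 1"
  by (simp_all add: of_op_def single_add single_diff single_uminus mult_single)

lemma of_op_sum: "of_op (sum f A) = (\<Sum>x\<in>A. of_op (f x))"
  by (induction A rule: infinite_finite_induct) (simp_all add: of_op_hom)

lemma mult_op_sum: "mult_op (sum f A) = (\<Sum>x\<in>A. mult_op (f x))"
  by (induction A rule: infinite_finite_induct) (simp_all add: mult_op_hom)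

lemma mult_op_uminus: "mult_op (- f) = - mult_op f"
  using mult_op_hom(1)[of f "- f"] by (simp add: mult_op_hom eq_neg_iff_add_eq_0 add.commute)

lemma const_op_hom:
  "const_op 0 = 0" "const_op 1 = 1"
  "const_op (a + b) = const_op a + const_op b"
  "const_op (a * b) = const_op a * const_op b"
  by (simp_all add: const_op_def mult.commute flip: mult_op_hom to_fract_add to_fract_mult one_pCons)

lemma of_csym_single: "of_csym (Poly_Mapping.single \<sigma> c) = Poly_Mapping.single \<sigma> (const_op c)"
  by (simp add: of_csym_def const_op_hom map_single)

lemma of_csym_add: "of_csym (\<gamma> + \<delta>) = of_csym \<gamma> + of_csym \<delta>"
  by (rule poly_mapping_eqI) (simp add: lookup_of_csym lookup_add const_op_hom)

lemma of_csym_0 [simp]: "of_csym 0 = 0"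
  by (rule poly_mapping_eqI) (simp add: lookup_of_csym const_op_hom)

lemma of_csym_1 [simp]: "of_csym 1 = 1"
  using of_csym_single[of 0 1] by (simp add: const_op_hom)

lemma of_csym_sum: "of_csym (sum f A) = (\<Sum>x\<in>A. of_csym (f x))"
  by (induction A rule: infinite_finite_induct) (simp_all add: of_csym_add)

lemma poly_mapping_eq_sum_single:
  "\<gamma> = (\<Sum>\<sigma>\<in>Poly_Mapping.keys \<gamma>. Poly_Mapping.single \<sigma> (Poly_Mapping.lookup \<gamma> \<sigma>))"
  by (rule poly_mapping_eqI)
     (simp add: lookup_sum lookup_single when_def in_keys_iff)

lemma of_csym_mult: "of_csym (\<gamma> * \<delta>) = of_csym \<gamma> * of_csym \<delta>"
proof -
  obtain c d A B where "\<gamma> = (\<Sum>\<sigma>\<in>A. Poly_Mapping.single \<sigma> (c \<sigma>))" "\<delta> = (\<Sum>\<tau>\<in>B. Poly_Mapping.single \<tau> (d \<tau>))"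
    using poly_mapping_eq_sum_single by metis
  then show ?thesis
    by (simp add: sum_product of_csym_sum of_csym_single mult_single const_op_hom)
qed

text \<open>\<open>of_op a\<close> sits at the neutral permutation, so only coefficients have to
  commute, and constants are central among differential operators.\<close>

lemma of_op_of_csym_commute: "of_op a * of_csym \<gamma> = of_csym \<gamma> * of_op a"
proof -
  obtain c A where "\<gamma> = (\<Sum>\<sigma>\<in>A. Poly_Mapping.single \<sigma> (c \<sigma>))"
    using poly_mapping_eq_sum_single by metis
  then show ?thesis
    by (simp add: of_op_def sum_distrib_left sum_distrib_right of_csym_sum of_csym_single mult_single
        const_op_central)
qed

lemma minus_one_power_commute: "(- 1) ^ k * x = x * (- 1 :: 'a :: ring_1) ^ k"
  by (induction k) (simp_all add: mult.assoc)

section \<open>The functions \<open>x_X\<close>, their derivatives, and summation over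
  \<open>Y\<close>\<close>

definition recip :: "(nat \<Rightarrow> complex) \<Rightarrow> nat set \<Rightarrow> ratfun" where
  "recip z X = (\<Prod>i\<in>X. 1 / (u_var + to_fract [:z i:]))"

lemma u_plus_const_nonzero: "u_var + to_fract [:c:] \<noteq> 0"
proof -
  have "u_var + to_fract [:c:] = to_fract [:c, 1:]"
    by (simp add: u_var_def flip: to_fract_add)
  then show ?thesis by simp
qed

lemma rf_deriv_recip_single:
  "rf_deriv (1 / (u_var + to_fract [:c:]))
    = - (1 / (u_var + to_fract [:c:])) * (1 / (u_var + to_fract [:c:]))"
proof -
  define f where "f = u_var + to_fract [:c:]"
  have "f \<noteq> 0" by (simp add: f_def u_plus_const_nonzero)
  have 1: "rf_deriv f = 1"
    by (simp add: f_def rf_deriv_add u_var_def rf_deriv_to_fract pderiv_pCons flip: one_pCons)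
  have "rf_deriv 1 = 0" using rf_deriv_to_fract[of 1] by simp
  then have "0 = rf_deriv (f * (1 / f))" using \<open>f \<noteq> 0\<close> by simp
  also have "\<dots> = 1 / f + f * rf_deriv (1 / f)" by (simp only: rf_deriv_mult 1 mult_1)
  finally have "f * rf_deriv (1 / f) = - (1 / f)" by (simp add: eq_neg_iff_add_eq_0 add.commute)
  then have "rf_deriv (1 / f) = - (1 / f) * (1 / f)"
    using \<open>f \<noteq> 0\<close> by (simp add: field_simps)
  then show ?thesis by (simp only: f_def)
qed

text \<open>Logarithmic differentiation. The summands \<open>x_X x_i\<close> are exactly the
  functions produced by pairs that meet in the single point \<open>i\<close>.\<close>

lemma rf_deriv_recip:
  assumes "finite X"
  shows "rf_deriv (recip z X) = - (\<Sum>i\<in>X. recip z X * recip z {i})"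
  using assms
proof (induction X rule: finite_induct)
  case empty
  then show ?case using rf_deriv_to_fract[of 1] by (simp add: recip_def)
next
  case (insert i X)
  have "recip z (insert i X) = recip z {i} * recip z X" using insert by (simp add: recip_def)
  moreover have "rf_deriv (recip z {i}) = - recip z {i} * recip z {i}"
    using rf_deriv_recip_single[of "z i"] by (simp add: recip_def)
  ultimately show ?case using insert
    by (simp add: rf_deriv_mult sum_distrib_left algebra_simps)
qed

lemma to_fract_const_prod: "to_fract [:\<Prod>i\<in>Y. f i:] = (\<Prod>i\<in>Y. to_fract [:f i:])"
proof (induction Y rule: infinite_finite_induct)
  case (insert i Y)
  have "[:f i * c:] = [:f i:] * [:c:]" for c by simp
  with insert show ?case by (simp del: mult_pCons_left mult_pCons_right)
qed (simp_all flip: one_pCons)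

text \<open>The degrees \<open>k\<close> and \<open>l\<close> are determined by the pair, and
  disjointness inside \<open>{1..n}\<close> already forces \<open>k + l \<le> n\<close>.\<close>

lemma sum_over_disjoint_pairs:
  "(\<Sum>(k, l)\<in>{(k, l). k + l \<le> n}. \<Sum>(X, Y)\<in>disjoint_pairs n k l. F k l X Y)
   = (\<Sum>X\<in>Pow {1..n}. \<Sum>Y\<in>Pow ({1..n} - X). F (card X) (card Y) X Y)"
proof -
  have fin: "finite X" if "X \<subseteq> {1..n}" for X using that finite_subset by blast
  have "(\<Sum>(k, l)\<in>{(k, l). k + l \<le> n}. \<Sum>(X, Y)\<in>disjoint_pairs n k l. F k l X Y)
      = (\<Sum>(p, q)\<in>Sigma {(k, l). k + l \<le> n} (\<lambda>p. disjoint_pairs n (fst p) (snd p)).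
          F (fst p) (snd p) (fst q) (snd q))"
    by (subst sum.Sigma[symmetric])
       (auto simp: finite_degree_pairs[unfolded case_prod_unfold] finite_disjoint_pairs case_prod_unfold)
  also have "\<dots> = (\<Sum>(X, Y)\<in>Sigma (Pow {1..n}) (\<lambda>X. Pow ({1..n} - X)). F (card X) (card Y) X Y)"
  proof (rule sum.reindex_bij_witness[of _ "\<lambda>(X, Y). ((card X, card Y), (X, Y))" "snd"])
    fix x assume x: "x \<in> Sigma (Pow {1..n}) (\<lambda>X. Pow ({1..n} - X))"
    then obtain X Y where [simp]: "x = (X, Y)" and XY: "X \<subseteq> {1..n}" "Y \<subseteq> {1..n}" "X \<inter> Y = {}" by auto
    then have "card X + card Y = card (X \<union> Y)" using fin by (simp add: card_Un_disjoint)
    also have "\<dots> \<le> card {1..n}" using XY by (intro card_mono) auto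
    finally have "card X + card Y \<le> n" by simp
    then show "(case x of (X, Y) \<Rightarrow> ((card X, card Y), (X, Y)))
        \<in> Sigma {(k, l). k + l \<le> n} (\<lambda>p. disjoint_pairs n (fst p) (snd p))"
      using XY by (simp add: disjoint_pairs_def)
  qed (auto simp: disjoint_pairs_def)
  also have "\<dots> = (\<Sum>X\<in>Pow {1..n}. \<Sum>Y\<in>Pow ({1..n} - X). F (card X) (card Y) X Y)"
    by (subst sum.Sigma) auto
  finally show ?thesis .
qed

text \<open>The sum expands the product of \<open>u + z_i\<close> over \<open>i\<close> outside
  \<open>X\<close>: take \<open>z_i\<close> on \<open>Y\<close> and \<open>u\<close> on the
  \<open>n - |X| - |Y|\<close> other points. Dividing by \<open>w\<close> leaves the reciprocals
  over \<open>X\<close>.\<close>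

lemma sum_pow_u_var:
  assumes "X \<subseteq> {1..n}"
  shows "(\<Sum>Y\<in>Pow ({1..n} - X). u_var ^ (n - card X - card Y) * to_fract [:\<Prod>i\<in>Y. z i:]) * (1 / w_poly n z)
    = recip z X"
proof -
  define V where "V = {1..n} - X"
  have V: "finite V" "card V = n - card X"
    using assms by (simp_all add: V_def card_Diff_subset finite_subset)
  have "(\<Sum>Y\<in>Pow V. u_var ^ (n - card X - card Y) * to_fract [:\<Prod>i\<in>Y. z i:])
      = (\<Sum>Y\<in>Pow V. (\<Prod>i\<in>Y. to_fract [:z i:]) * (\<Prod>i\<in>V - Y. u_var))"
    using V by (intro sum.cong refl) (auto simp: to_fract_const_prod card_Diff_subset finite_subset)
  also have "\<dots> = (\<Prod>i\<in>V. to_fract [:z i:] + u_var)"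
    using V by (simp add: prod_add)
  finally have 1: "(\<Sum>Y\<in>Pow V. u_var ^ (n - card X - card Y) * to_fract [:\<Prod>i\<in>Y. z i:])
    = (\<Prod>i\<in>V. u_var + to_fract [:z i:])" by (simp add: add.commute)
  have "w_poly n z = (\<Prod>i\<in>V. u_var + to_fract [:z i:]) * (\<Prod>i\<in>X. u_var + to_fract [:z i:])"
    unfolding w_poly_def V_def by (rule prod.subset_diff[OF assms]) simp
  moreover have "(\<Prod>i\<in>A. u_var + to_fract [:z i:]) \<noteq> 0" for A
    by (cases "finite A") (simp_all add: u_plus_const_nonzero)
  ultimately show ?thesis unfolding V_def[symmetric] 1 recip_def by (simp add: prod_dividef)
qed

lemma sym_grp_on_eq: "X \<subseteq> {1..n} \<Longrightarrow> sym_grp_on n X = perms_on X"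
  unfolding sym_grp_on_def sym_grp_def perms_on_def by blast

lemma alpha_plus_eq: "X \<subseteq> {1..n} \<Longrightarrow> alpha_plus n X = sym_sum (\<lambda>_. 1) X"
  by (simp add: alpha_plus_def sym_sum_def sym_grp_on_eq)

lemma alpha_minus_eq: "X \<subseteq> {1..n} \<Longrightarrow> alpha_minus n X = sym_sum sgn_perm X"
  by (simp add: alpha_minus_def sym_sum_def sym_grp_on_eq sgn_perm_def)

lemma D_plus_eq:
  "D_plus n z = (\<Sum>X\<in>Pow {1..n}.
    of_op (d_u ^ (n - card X) * mult_op (recip z X)) * of_csym (sym_sum (\<lambda>_. 1) X))"
proof -
  let ?m = "\<lambda>k l Y. u_var ^ (n - k - l) * to_fract [:\<Prod>i\<in>Y. z i:]"
  have "of_op (d_u ^ (n - k) * mult_op (u_var ^ (n - k - l))) * of_csym (beta_plus n z k l)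
      = (\<Sum>(X, Y)\<in>disjoint_pairs n k l.
          of_op (d_u ^ (n - k) * mult_op (?m k l Y)) * of_csym (alpha_plus n X))" for k l
    by (simp add: beta_plus_def of_csym_sum of_csym_mult of_csym_single sum_distrib_left case_prod_unfold
        of_op_def[symmetric] of_op_of_csym_commute[symmetric] mult_op_hom of_op_hom const_op_def mult.assoc)
  then have "D_plus n z = (\<Sum>X\<in>Pow {1..n}. \<Sum>Y\<in>Pow ({1..n} - X).
      of_op (d_u ^ (n - card X) * mult_op (?m (card X) (card Y) Y)) * of_csym (alpha_plus n X))
      * of_op (mult_op (1 / w_poly n z))"
    by (simp only: D_plus_def sum_over_disjoint_pairs)
  also have "\<dots> = (\<Sum>X\<in>Pow {1..n}. of_op (d_u ^ (n - card X) *
      mult_op ((\<Sum>Y\<in>Pow ({1..n} - X). ?m (card X) (card Y) Y) * (1 / w_poly n z)))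
      * of_csym (alpha_plus n X))"
  proof -
    \<comment> \<open>The factor \<open>1/w\<close> on the far right passes the group algebra
      element and merges with the function there.\<close>
    have "of_op (a * mult_op f) * of_csym \<gamma> * of_op (mult_op g)
        = of_op (a * mult_op (f * g)) * of_csym \<gamma>" for a f g \<gamma>
      by (simp only: mult.assoc of_op_of_csym_commute[symmetric] mult_op_hom of_op_hom)
    then show ?thesis
      by (simp only: sum_distrib_left sum_distrib_right mult_op_sum of_op_sum)
  qed
  also have "\<dots> = (\<Sum>X\<in>Pow {1..n}.
      of_op (d_u ^ (n - card X) * mult_op (recip z X)) * of_csym (sym_sum (\<lambda>_. 1) X))"
    by (intro sum.cong refl) (simp only: sum_pow_u_var Pow_iff alpha_plus_eq)
  finally show ?thesis .
qed

lemma D_minus_eq: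
  "D_minus n z = (\<Sum>X\<in>Pow {1..n}. (- 1) ^ card X * of_csym (sym_sum sgn_perm X)
     * of_op (mult_op (recip z X) * d_u ^ (n - card X)))"
proof -
  let ?m = "\<lambda>k l Y. u_var ^ (n - k - l) * to_fract [:\<Prod>i\<in>Y. z i:]"
  have "(- 1) ^ k * of_csym (beta_minus n z k l) * of_op (mult_op (u_var ^ (n - k - l)) * d_u ^ (n - k))
      = (\<Sum>(X, Y)\<in>disjoint_pairs n k l.
          (- 1) ^ k * of_csym (alpha_minus n X) * of_op (mult_op (?m k l Y) * d_u ^ (n - k)))" for k l
    by (simp add: beta_minus_def of_csym_sum of_csym_mult of_csym_single sum_distrib_left sum_distrib_right
        case_prod_unfold of_op_def[symmetric] mult_op_hom of_op_hom const_op_def mult.assoc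
        mult.commute[of "u_var ^ _"])
  then have "D_minus n z = of_op (mult_op (1 / w_poly n z)) * (\<Sum>X\<in>Pow {1..n}. \<Sum>Y\<in>Pow ({1..n} - X).
      (- 1) ^ card X * of_csym (alpha_minus n X) * of_op (mult_op (?m (card X) (card Y) Y) * d_u ^ (n - card X)))"
    by (simp only: D_minus_def sum_over_disjoint_pairs)
  also have "\<dots> = (\<Sum>X\<in>Pow {1..n}. \<Sum>Y\<in>Pow ({1..n} - X). (- 1) ^ card X * of_csym (alpha_minus n X) *
      of_op (mult_op (1 / w_poly n z) * (mult_op (?m (card X) (card Y) Y) * d_u ^ (n - card X))))"
    unfolding sum_distrib_left
  proof (intro sum.cong refl)
    fix X Y :: "nat set"
    let ?W = "of_op (mult_op (1 / w_poly n z))"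
      and ?R = "of_op (mult_op (?m (card X) (card Y) Y) * d_u ^ (n - card X))"
    \<comment> \<open>Here \<open>1/w\<close> stands on the left and has to pass both the sign and
      \<open>alpha^-\<close> to reach the function.\<close>
    have "?W * ((- 1) ^ card X * of_csym (alpha_minus n X) * ?R)
        = (- 1) ^ card X * (?W * of_csym (alpha_minus n X)) * ?R"
      by (simp only: mult.assoc[symmetric] minus_one_power_commute[of _ ?W])
    then show "?W * ((- 1) ^ card X * of_csym (alpha_minus n X) * ?R)
        = (- 1) ^ card X * of_csym (alpha_minus n X) *
      of_op (mult_op (1 / w_poly n z) * (mult_op (?m (card X) (card Y) Y) * d_u ^ (n - card X)))"
      by (simp only: of_op_of_csym_commute of_op_hom mult.assoc)
  qed
  also have "\<dots> = (\<Sum>X\<in>Pow {1..n}. (- 1) ^ card X * of_csym (alpha_minus n X) * of_op (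
      mult_op ((\<Sum>Y\<in>Pow ({1..n} - X). ?m (card X) (card Y) Y) * (1 / w_poly n z)) * d_u ^ (n - card X)))"
  proof -
    have "mult_op g * (mult_op f * a) = mult_op (f * g) * a" for a f g
      by (simp only: mult.assoc[symmetric] mult_op_hom(2)[symmetric] mult.commute)
    then show ?thesis
      by (simp only: sum_distrib_left sum_distrib_right mult_op_sum of_op_sum)
  qed
  also have "\<dots> = (\<Sum>X\<in>Pow {1..n}. (- 1) ^ card X * of_csym (sym_sum sgn_perm X)
     * of_op (mult_op (recip z X) * d_u ^ (n - card X)))"
    by (intro sum.cong refl) (simp only: sum_pow_u_var Pow_iff alpha_minus_eq)
  finally show ?thesis .
qed

text \<open>Disjoint pairs correspond to \<open>(U, Q)\<close> with \<open>Q = Y\<close>, and pairs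
  meeting in one point \<open>i\<close> to \<open>(U, i, Q)\<close> with \<open>Q = Y - {i}\<close>,
  where \<open>U = X \<union> Y\<close>.\<close>

lemma sum_pairs_by_union:
  fixes F :: "'a set \<Rightarrow> 'a set \<Rightarrow> 'b :: comm_monoid_add"
  assumes N: "finite N"
    and zero: "\<And>X Y p q. p \<in> X \<inter> Y \<Longrightarrow> q \<in> X \<inter> Y \<Longrightarrow> p \<noteq> q \<Longrightarrow> F X Y = 0"
  shows "(\<Sum>X\<in>Pow N. \<Sum>Y\<in>Pow N. F X Y)
    = (\<Sum>U\<in>Pow N. (\<Sum>Q\<in>Pow U. F (U - Q) Q)
        + (\<Sum>i\<in>U. \<Sum>Q\<in>Pow (U - {i}). F (insert i (U - {i} - Q)) (insert i Q)))"
proof -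
  let ?A = "{(X, Y) \<in> Pow N \<times> Pow N. X \<inter> Y = {}}"
  let ?B = "{(X, Y) \<in> Pow N \<times> Pow N. \<exists>i. X \<inter> Y = {i}}"
  have fin: "finite U" if "U \<subseteq> N" for U using that N finite_subset by blast
  have "(\<Sum>X\<in>Pow N. \<Sum>Y\<in>Pow N. F X Y) = (\<Sum>(X, Y)\<in>Pow N \<times> Pow N. F X Y)"
    by (rule sum.cartesian_product)
  also have "\<dots> = (\<Sum>(X, Y)\<in>?A \<union> ?B. F X Y)"
  proof (rule sum.mono_neutral_right)
    show "\<forall>x\<in>Pow N \<times> Pow N - (?A \<union> ?B). (case x of (X, Y) \<Rightarrow> F X Y) = 0"
    proof
      fix x assume x: "x \<in> Pow N \<times> Pow N - (?A \<union> ?B)"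
      obtain X Y where [simp]: "x = (X, Y)" by (cases x)
      from x have ne: "X \<inter> Y \<noteq> {}" and ns: "X \<inter> Y \<noteq> {i}" for i by simp_all
      from ne obtain p where p: "p \<in> X \<inter> Y" by blast
      with ns[of p] obtain q where "q \<in> X \<inter> Y" "p \<noteq> q" by blast
      with p zero show "(case x of (X, Y) \<Rightarrow> F X Y) = 0" by simp
    qed
  qed (use N in auto)
  also have "\<dots> = (\<Sum>(X, Y)\<in>?A. F X Y) + (\<Sum>(X, Y)\<in>?B. F X Y)"
  proof (rule sum.union_disjoint)
    show "finite ?A" "finite ?B" using N by (auto intro: finite_subset[of _ "Pow N \<times> Pow N"])
  qed auto
  also have "(\<Sum>(X, Y)\<in>?A. F X Y) = (\<Sum>(U, Q)\<in>Sigma (Pow N) Pow. F (U - Q) Q)"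
    by (rule sum.reindex_bij_witness[of _ "\<lambda>(U, Q). (U - Q, Q)" "\<lambda>(X, Y). (X \<union> Y, Y)"])
       (auto simp: Diff_triv Un_Diff)
  also have "\<dots> = (\<Sum>U\<in>Pow N. \<Sum>Q\<in>Pow U. F (U - Q) Q)"
    using N fin by (subst sum.Sigma) auto
  also have "(\<Sum>(X, Y)\<in>?B. F X Y) = (\<Sum>(U, i, Q)\<in>Sigma (Pow N) (\<lambda>U. Sigma U (\<lambda>i. Pow (U - {i}))).
      F (insert i (U - {i} - Q)) (insert i Q))"
  proof (rule sum.reindex_bij_witness[of _ "\<lambda>(U, i, Q). (insert i (U - {i} - Q), insert i Q)"
        "\<lambda>(X, Y). (X \<union> Y, the_elem (X \<inter> Y), Y - X)"])
    fix x assume "x \<in> ?B"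
    then obtain X Y i where [simp]: "x = (X, Y)" and i: "X \<inter> Y = {i}" and sub: "X \<subseteq> N" "Y \<subseteq> N" by auto
    from i have "insert i (X \<union> Y - {i} - (Y - X)) = X" "insert i (Y - X) = Y" by blast+
    moreover have "i \<in> X \<union> Y" "Y - X \<subseteq> X \<union> Y - {i}" using i by blast+
    ultimately show "(case case x of (X, Y) \<Rightarrow> (X \<union> Y, the_elem (X \<inter> Y), Y - X) of
         (U, i, Q) \<Rightarrow> (insert i (U - {i} - Q), insert i Q)) = x"
      "(case x of (X, Y) \<Rightarrow> (X \<union> Y, the_elem (X \<inter> Y), Y - X))
         \<in> Sigma (Pow N) (\<lambda>U. Sigma U (\<lambda>i. Pow (U - {i})))"
      "(case case x of (X, Y) \<Rightarrow> (X \<union> Y, the_elem (X \<inter> Y), Y - X) of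
         (U, i, Q) \<Rightarrow> F (insert i (U - {i} - Q)) (insert i Q)) = (case x of (X, Y) \<Rightarrow> F X Y)"
      using i sub by simp_all
  next
    fix x assume "x \<in> Sigma (Pow N) (\<lambda>U. Sigma U (\<lambda>i. Pow (U - {i})))"
    then obtain U i Q where [simp]: "x = (U, i, Q)" and x: "U \<subseteq> N" "i \<in> U" "Q \<subseteq> U - {i}" by auto
    from x have e: "insert i (U - {i} - Q) \<inter> insert i Q = {i}" "insert i (U - {i} - Q) \<union> insert i Q = U"
      "insert i Q - insert i (U - {i} - Q) = Q" by blast+
    then show "(case case x of (U, i, Q) \<Rightarrow> (insert i (U - {i} - Q), insert i Q) of
         (X, Y) \<Rightarrow> (X \<union> Y, the_elem (X \<inter> Y), Y - X)) = x"
      by (simp only: \<open>x = _\<close> prod.case the_elem_eq)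
    show "(case x of (U, i, Q) \<Rightarrow> (insert i (U - {i} - Q), insert i Q)) \<in> ?B"
      using e x by (simp only: \<open>x = _\<close> prod.case mem_Collect_eq) blast
  qed
  also have "\<dots> = (\<Sum>U\<in>Pow N. \<Sum>i\<in>U. \<Sum>Q\<in>Pow (U - {i}). F (insert i (U - {i} - Q)) (insert i Q))"
    using N fin by (simp add: sum.Sigma finite_subset)
  finally show ?thesis by (simp only: sum.distrib)
qed

text \<open>Summation by parts. The conditional stands for \<open>T\<close> being 0 at index -1,
  where truncated subtraction would give \<open>T 0\<close>.\<close>

lemma alternating_telescope:
  fixes E T :: "nat \<Rightarrow> 'a :: ring_1"
  shows "(\<Sum>b\<le>m. (- 1) ^ b * (E b * (T b + (if b = 0 then 0 else T (b - 1)))))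
       = (\<Sum>q<m. (- 1) ^ q * ((E q - E (Suc q)) * T q)) + (- 1) ^ m * (E m * T m)"
  by (induction m) (simp_all add: algebra_simps)

section \<open>Cancellation\<close>

text \<open>Normal form of a summand of the product: sign, then differential operator, then group
  algebra element.\<close>

definition pair_term :: "nat \<Rightarrow> (nat \<Rightarrow> complex) \<Rightarrow> nat set \<Rightarrow> nat set \<Rightarrow> dsym" where
  "pair_term n z X Y = (- 1) ^ card Y *
     (of_op (d_u ^ (n - card X) * mult_op (recip z X * recip z Y) * d_u ^ (n - card Y))
     * of_csym (sym_sum (\<lambda>_. 1) X * sym_sum sgn_perm Y))"

lemma D_plus_D_minus: "D_plus n z * D_minus n z = (\<Sum>X\<in>Pow {1..n}. \<Sum>Y\<in>Pow {1..n}. pair_term n z X Y)"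
  unfolding D_plus_eq D_minus_eq sum_product
proof (intro sum.cong refl)
  fix X Y :: "nat set"
  let ?A = "of_op (d_u ^ (n - card X) * mult_op (recip z X))" and ?a = "of_csym (sym_sum (\<lambda>_. 1) X)"
  let ?B = "of_op (mult_op (recip z Y) * d_u ^ (n - card Y))" and ?b = "of_csym (sym_sum sgn_perm Y)"
  \<comment> \<open>The sign moves to the front, and operators pass group algebra elements; the
    order within each kind is kept.\<close>
  have "?A * ?a * ((- 1) ^ card Y * ?b * ?B) = (?A * ?a * (- 1) ^ card Y) * (?b * ?B)"
    by (simp only: mult.assoc)
  also have "\<dots> = (- 1) ^ card Y * (?A * ?a * (?B * ?b))"
    by (simp only: minus_one_power_commute[symmetric] of_op_of_csym_commute mult.assoc)
  also have "?A * ?a * (?B * ?b) = ?A * (?a * ?B) * ?b"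
    by (simp only: mult.assoc)
  also have "?A * (?a * ?B) * ?b = (?A * ?B) * (?a * ?b)"
    by (simp only: of_op_of_csym_commute[symmetric] mult.assoc)
  also have "(- 1) ^ card Y * \<dots> = pair_term n z X Y"
    by (simp only: pair_term_def of_op_hom of_csym_mult mult_op_hom mult.assoc)
  finally show "?A * ?a * ((- 1) ^ card Y * ?b * ?B) = pair_term n z X Y" .
qed

lemma sum_Pow_by_card:
  assumes "finite U" "card U = m" and f: "\<And>Q. Q \<subseteq> U \<Longrightarrow> f Q = g (card Q) Q"
  shows "(\<Sum>Q\<in>Pow U. f Q) = (\<Sum>b\<le>m. \<Sum>Q | Q \<subseteq> U \<and> card Q = b. g b Q)"
proof -
  have "(\<Sum>Q\<in>Pow U. f Q) = (\<Sum>Q\<in>Pow U. g (card Q) Q)"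
    using f by (intro sum.cong) auto
  also have "\<dots> = (\<Sum>b\<le>m. \<Sum>Q\<in>{Q \<in> Pow U. card Q = b}. g (card Q) Q)"
    using assms by (intro sum.group[symmetric]) (auto intro: card_mono)
  also have "\<dots> = (\<Sum>b\<le>m. \<Sum>Q | Q \<subseteq> U \<and> card Q = b. g b Q)"
    by (intro sum.cong) auto
  finally show ?thesis .
qed

text \<open>For \<open>X = U - Q\<close> the functions multiply to \<open>x_U\<close>, and
  \<open>n - |X| = n - m + |Q|\<close> because \<open>|Q| \<le> m \<le> n\<close>. The operator thus
  depends on \<open>|Q|\<close> alone.\<close>

lemma disjoint_terms:
  assumes U: "finite U" "card U = m" "m \<le> n"
  shows "(\<Sum>Q\<in>Pow U. pair_term n z (U - Q) Q)
    = (\<Sum>b\<le>m. (- 1) ^ b *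
        (of_op (d_u ^ (n - m + b) * mult_op (recip z U) * d_u ^ (n - b)) * of_csym (disj_sum U b)))"
proof -
  have "pair_term n z (U - Q) Q = (- 1) ^ card Q *
      (of_op (d_u ^ (n - m + card Q) * mult_op (recip z U) * d_u ^ (n - card Q))
      * of_csym (sym_sum (\<lambda>_. 1) (U - Q) * sym_sum sgn_perm Q))" if Q: "Q \<subseteq> U" for Q
  proof -
    have "finite Q" "card Q \<le> m" using Q U finite_subset by (auto intro: card_mono)
    then have "n - card (U - Q) = n - m + card Q"
      using Q U by (simp add: card_Diff_subset)
    moreover have "recip z (U - Q) * recip z Q = recip z U"
      unfolding recip_def by (rule prod.subset_diff[OF Q U(1), symmetric])
    ultimately show ?thesis by (simp add: pair_term_def)
  qed
  then show ?thesis
    unfolding disj_sum_def of_csym_sum sum_distrib_left by (rule sum_Pow_by_card[OF U(1,2)])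
qed

text \<open>The point \<open>i\<close> is counted in both blocks, which gives the extra factor
  \<open>x_i\<close> and, since \<open>|Y| = q + 1\<close>, the exponents \<open>Suc q\<close>. As
  \<open>|U - {i}| = m - 1\<close>, the index stops below \<open>m\<close>.\<close>

lemma meeting_terms:
  assumes U: "finite U" "card U = m" "m \<le> n" and i: "i \<in> U"
  shows "(\<Sum>Q\<in>Pow (U - {i}). pair_term n z (insert i (U - {i} - Q)) (insert i Q))
    = (\<Sum>q<m. (- 1) ^ Suc q *
        (of_op (d_u ^ (n - m + q) * mult_op (recip z U * recip z {i}) * d_u ^ (n - Suc q))
        * of_csym (meet_sum (U - {i}) i q)))"
proof -
  let ?V = "U - {i}"
  have V: "finite ?V" "card ?V = m - 1" and m: "m \<ge> 1"
    using U i by (auto simp: Suc_le_eq card_gt_0_iff)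
  have "pair_term n z (insert i (?V - Q)) (insert i Q) = (- 1) ^ Suc (card Q) *
      (of_op (d_u ^ (n - m + card Q) * mult_op (recip z U * recip z {i}) * d_u ^ (n - Suc (card Q)))
      * of_csym (sym_sum (\<lambda>_. 1) (insert i (?V - Q)) * sym_sum sgn_perm (insert i Q)))" if Q: "Q \<subseteq> ?V" for Q
  proof -
    have fin: "finite Q" "i \<notin> Q" using Q V finite_subset by auto
    have "card Q \<le> m - 1" using card_mono[OF V(1) Q] V by simp
    moreover have "card (?V - Q) = m - 1 - card Q" using fin Q V by (simp only: card_Diff_subset)
    ultimately have "n - card (insert i (?V - Q)) = n - m + card Q"
      using V m U(3) by simp
    moreover have "recip z U = recip z (?V - Q) * recip z (insert i Q)"
    proof -
      have "U - insert i Q = ?V - Q" by auto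
      moreover have "insert i Q \<subseteq> U" using Q i by auto
      ultimately show ?thesis
        unfolding recip_def using prod.subset_diff[of "insert i Q" U] U(1) by metis
    qed
    moreover have "recip z (insert i (?V - Q)) = recip z {i} * recip z (?V - Q)"
      using V by (simp add: recip_def)
    ultimately show ?thesis using fin by (simp add: pair_term_def mult.commute mult.left_commute)
  qed
  moreover have "{..<m} = {..m - 1}" using m by auto
  ultimately show ?thesis
    unfolding meet_sum_def of_csym_sum sum_distrib_left by (simp only: sum_Pow_by_card[OF V])
qed

lemma sum_by_union_eq_0:
  assumes U: "U \<subseteq> {1..n}" "U \<noteq> {}"
  shows "(\<Sum>Q\<in>Pow U. pair_term n z (U - Q) Q)
    + (\<Sum>i\<in>U. \<Sum>Q\<in>Pow (U - {i}). pair_term n z (insert i (U - {i} - Q)) (insert i Q)) = 0"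
proof -
  obtain j where j: "j \<in> U" using U by blast
  define m where "m = card U"
  have fin: "finite U" using U finite_subset by blast
  have m: "m \<le> n" using card_mono[OF _ U(1)] by (simp add: m_def)
  define E where "E b = of_op (d_u ^ (n - m + b) * mult_op (recip z U) * d_u ^ (n - b))" for b
  \<comment> \<open>By \<open>meet_sum_indep\<close> the one choice \<open>j\<close> serves every
    \<open>i\<close> in \<open>U\<close>, so the sum over \<open>i\<close> acts on the functions
    only.\<close>
  define T where "T q = of_csym (meet_sum (U - {j}) j q)" for q
  \<comment> \<open>\<open>U - {j}\<close> has only \<open>m - 1\<close> elements; this removes the
    boundary term of the summation by parts.\<close>
  have Tm: "T m = 0"
    using fin j by (simp add: T_def m_def meet_sum_card_lt card_Diff1_less del: card_Diff_insert)
  have C: "of_csym (disj_sum U b) = T b + (if b = 0 then 0 else T (b - 1))" for b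
    using meet_sum_0[of "U - {j}" j] meet_sum_rec[of "U - {j}" j "b - 1"] fin j
    by (cases b) (simp_all add: T_def insert_absorb flip: of_csym_add)
  have deriv: "(\<Sum>i\<in>U. of_op (d_u ^ (n - m + q) * mult_op (recip z U * recip z {i}) * d_u ^ (n - Suc q)))
      = E q - E (Suc q)" if "q < m" for q
  proof -
    \<comment> \<open>One derivative is split off the right-hand power to form the commutator of
      \<open>x_U\<close> with \<open>d_u\<close>, which is the sum of the
      \<open>x_U x_i\<close>.\<close>
    have "n - q = Suc (n - Suc q)" using that m by simp
    have "mult_op (\<Sum>i\<in>U. recip z U * recip z {i}) = mult_op (recip z U) * d_u - d_u * mult_op (recip z U)"
      using d_u_commutator[of "recip z U"] rf_deriv_recip[OF fin, of z]
      by (simp add: mult_op_uminus algebra_simps)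
    then have "(\<Sum>i\<in>U. of_op (d_u ^ (n - m + q) * mult_op (recip z U * recip z {i}) * d_u ^ (n - Suc q)))
      = of_op (d_u ^ (n - m + q) * (mult_op (recip z U) * d_u - d_u * mult_op (recip z U)) * d_u ^ (n - Suc q))"
      by (simp only: of_op_sum[symmetric] sum_distrib_left[symmetric] sum_distrib_right[symmetric]
          mult_op_sum[symmetric])
    also have "\<dots> = E q - E (Suc q)"
      unfolding E_def \<open>n - q = _\<close>
      by (simp only: add_Suc_right power_Suc2[of d_u "n - m + q"] power_Suc[of d_u "n - Suc q"]
          of_op_hom(2)[symmetric] left_diff_distrib right_diff_distrib mult.assoc)
    finally show ?thesis .
  qed
  have "(\<Sum>i\<in>U. \<Sum>Q\<in>Pow (U - {i}). pair_term n z (insert i (U - {i} - Q)) (insert i Q))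
      = (\<Sum>i\<in>U. \<Sum>q<m. (- 1) ^ Suc q *
          (of_op (d_u ^ (n - m + q) * mult_op (recip z U * recip z {i}) * d_u ^ (n - Suc q)) * T q))"
    using meeting_terms[OF fin m_def[symmetric] m] meet_sum_indep[OF fin _ j]
    by (simp add: T_def)
  also have "\<dots> = (\<Sum>q<m. \<Sum>i\<in>U. (- 1) ^ Suc q *
          (of_op (d_u ^ (n - m + q) * mult_op (recip z U * recip z {i}) * d_u ^ (n - Suc q)) * T q))"
    by (rule sum.swap)
  also have "\<dots> = (\<Sum>q<m. (- 1) ^ Suc q * ((E q - E (Suc q)) * T q))"
    by (intro sum.cong refl)
       (simp only: sum_distrib_left[symmetric] sum_distrib_right[symmetric] deriv lessThan_iff)
  also have "\<dots> = - (\<Sum>q<m. (- 1) ^ q * ((E q - E (Suc q)) * T q))"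
    by (simp add: sum_negf)
  finally show ?thesis
    unfolding disjoint_terms[OF fin m_def[symmetric] m] C
    using alternating_telescope[of E T m] by (simp add: Tm flip: E_def)
qed

theorem theorem1p2:
  fixes n :: nat and z :: "nat \<Rightarrow> complex"
  assumes "n \<ge> 1"
  shows "D_plus n z * D_minus n z = of_op (d_u ^ (2 * n))"
proof -
  let ?S = "\<lambda>U. (\<Sum>Q\<in>Pow U. pair_term n z (U - Q) Q)
    + (\<Sum>i\<in>U. \<Sum>Q\<in>Pow (U - {i}). pair_term n z (insert i (U - {i} - Q)) (insert i Q))"
  have "D_plus n z * D_minus n z = (\<Sum>U\<in>Pow {1..n}. ?S U)"
    unfolding D_plus_D_minus
    by (rule sum_pairs_by_union) (simp_all add: pair_term_def sym_sum_annihilate)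
  \<comment> \<open>Only the pair of empty sets survives; its functions and group algebra elements
    are 1, leaving two factors \<open>d_u ^ n\<close>.\<close>
  also have "\<dots> = (\<Sum>U\<in>{{}}. ?S U)"
    by (rule sum.mono_neutral_right) (use sum_by_union_eq_0 in auto)
  also have "\<dots> = of_op (d_u ^ (2 * n))"
    by (simp add: pair_term_def recip_def sym_sum_trivial mult_op_hom mult_2 power_add)
  finally show ?thesis .
qed

end
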